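(* Let $f:\mathbb{R}^d\to\mathbb{R}$ be locally Lipschitz with optimal value $f^\ast$ and nonempty set of minimizers $\mathcal{X}_\ast$, let $\bar x\in\mathcal{X}_\ast$ and $\delta>0$, and suppose the sharpness assumption (constant $\mu$) and the $(b)$-regularity assumption (mapping $g$, constants $C_{(b)},\eta$) stated in the context hold at $\bar x$. Let $L$ be an upper bound for the norms of all elements of $\bigcup_{x\in B_\delta(\bar x)}g(x)$ and also a Lipschitz constant of $f$ on $B_\delta(\bar x)$. Let $C_{\mathsf s}>0$ be a constant such that for all $\tau>3/\mu$ and all $x$ with $$\|x-\bar x\|<\frac{\delta}{4},\qquad\mathrm{dist}(x,\mathcal{X}_\ast)\le\min\left\{\left(\frac{\mu}{2C_{(b)}}\right)^{1/\eta},\left(\frac{\mu^{1-\eta}}{LC_{\mathsf s}}\right)^{1/\eta}\right\}\qquad(\star)$$ the point $\tilde x=\mathtt{PolyakBundle}(x,\tau)$ satisfies $f(\tilde x)-f^\ast\le C_{\mathsf s}(f(x)-f^\ast)^{1+\eta}$. Let $\tau>3/\mu$ and let $x$ satisfy $(\star)$. Then there exists a method that returns the point $\tilde x=\mathtt{PolyakBundle}(x,\tau)$ using at most $O(d^3)$ floating point operations (ignoring the cost of evaluations of $f$ and $g$).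
   Context: $\|\cdot\|$ is the Euclidean norm, $B_r(x)$ is the open ball, $\mathrm{dist}$ is Euclidean distance to a set, $A^\dagger$ is the Moore–Penrose pseudoinverse, $f^\ast=\min f$, $\mathcal{X}_\ast=\operatorname{argmin}f\ne\emptyset$. A floating point operation (flop) is a single scalar arithmetic operation in exact arithmetic (including square roots). Sharpness assumption: $f(x)-f^\ast\ge\mu\,\mathrm{dist}(x,\mathcal{X}_\ast)$ for all $x\in B_\delta(\bar x)$, where $\mu>0$. $(b)$-regularity assumption: $g$ assigns to each $x\in\mathbb{R}^d$ a nonempty set $g(x)\subseteq\mathbb{R}^d$, is locally bounded, and there are $C_{(b)},\eta>0$ with $|f(x)+\langle v,y-x\rangle-f^\ast|\le C_{(b)}\|y-x\|^{1+\eta}$ for all $x\in B_\delta(\bar x)$, $v\in g(x)$, $y\in\mathcal{X}_\ast\cap B_{2\delta}(\bar x)$. Procedure $\mathtt{PolyakBundle}(x,\tau)$: set $y_0=x$ and choose any $v_0\in g(y_0)$. For $i=1,\dots,d$: let $A_i\in\mathbb{R}^{i\times d}$ have rows $v_0^T,\dots,v_{i-1}^T$, set $y_i=y_0-A_i^\dagger[f(y_j)-f^\ast+\langle v_j,y_0-y_j\rangle]_{j=0}^{i-1}$, and choose any $v_i\in g(y_i)$. Return $y_s$, where $s$ minimizes $f(y_i)$ over those $i\in\{1,\dots,d\}$ with $\|y_i-y_0\|\le\tau(f(y_0)-f^\ast)$ (the output is $\emptyset$ if there is no such $i$). *)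

theory Defs
  imports Complex_Main "Jordan_Normal_Form.Matrix"
begin

text \<open>The dimension \<open>d\<close> has to vary inside the statement, because the constant hidden in
  \<open>O(d\<^sup>3)\<close> does not depend on it.  Hence \<open>\<real>\<^sup>d\<close> is \<^term>\<open>carrier_vec d :: real vec set\<close>, and
  functions on \<open>\<real>\<^sup>d\<close> are HOL functions on \<^typ>\<open>real vec\<close> of which only the values on the
  carrier matter.\<close>

section \<open>Euclidean geometry\<close>

definition enorm :: "real vec \<Rightarrow> real" where
  "enorm x = sqrt (x \<bullet> x)"

definition eball :: "nat \<Rightarrow> real vec \<Rightarrow> real \<Rightarrow> real vec set" where
  "eball d c r = {y \<in> carrier_vec d. enorm (y - c) < r}"

definition edist_set :: "real vec \<Rightarrow> real vec set \<Rightarrow> real" where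
  "edist_set x S = (INF y\<in>S. enorm (x - y))"

definition lipschitz_with :: "real \<Rightarrow> (real vec \<Rightarrow> real) \<Rightarrow> real vec set \<Rightarrow> bool" where
  "lipschitz_with L f S \<longleftrightarrow> (\<forall>x\<in>S. \<forall>y\<in>S. \<bar>f x - f y\<bar> \<le> L * enorm (x - y))"

definition locally_lipschitz :: "nat \<Rightarrow> (real vec \<Rightarrow> real) \<Rightarrow> bool" where
  "locally_lipschitz d f \<longleftrightarrow>
     (\<forall>x\<in>carrier_vec d. \<exists>r>0. \<exists>K. lipschitz_with K f (eball d x r))"

section \<open>Minimizers, sharpness and \<open>(b)\<close>-regularity\<close>

definition min_val :: "nat \<Rightarrow> (real vec \<Rightarrow> real) \<Rightarrow> real" where
  "min_val d f = (INF x\<in>carrier_vec d. f x)"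

definition argmin_set :: "nat \<Rightarrow> (real vec \<Rightarrow> real) \<Rightarrow> real vec set" where
  "argmin_set d f = {x \<in> carrier_vec d. \<forall>y\<in>carrier_vec d. f x \<le> f y}"

definition sharp :: "nat \<Rightarrow> (real vec \<Rightarrow> real) \<Rightarrow> real vec \<Rightarrow> real \<Rightarrow> real \<Rightarrow> bool" where
  "sharp d f xbar \<delta> \<mu> \<longleftrightarrow> 0 < \<mu> \<and>
     (\<forall>x\<in>eball d xbar \<delta>. f x - min_val d f \<ge> \<mu> * edist_set x (argmin_set d f))"

definition locally_bounded :: "nat \<Rightarrow> (real vec \<Rightarrow> real vec set) \<Rightarrow> bool" where
  "locally_bounded d g \<longleftrightarrow>
     (\<forall>x\<in>carrier_vec d. \<exists>r>0. \<exists>K. \<forall>z\<in>eball d x r. \<forall>v\<in>g z. enorm v \<le> K)"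

definition b_regular ::
  "nat \<Rightarrow> (real vec \<Rightarrow> real) \<Rightarrow> (real vec \<Rightarrow> real vec set) \<Rightarrow> real vec \<Rightarrow> real \<Rightarrow> real \<Rightarrow> real \<Rightarrow> bool"
where
  "b_regular d f g xbar \<delta> Cb \<eta> \<longleftrightarrow>
     (\<forall>x\<in>carrier_vec d. g x \<noteq> {} \<and> g x \<subseteq> carrier_vec d) \<and>
     locally_bounded d g \<and> 0 < Cb \<and> 0 < \<eta> \<and>
     (\<forall>x\<in>eball d xbar \<delta>. \<forall>v\<in>g x. \<forall>y\<in>argmin_set d f \<inter> eball d xbar (2 * \<delta>).
        \<bar>f x + v \<bullet> (y - x) - min_val d f\<bar> \<le> Cb * enorm (y - x) powr (1 + \<eta>))"

text \<open>For \<open>L = 0\<close> the second term of the minimum is \<open>0\<close> here (division by zero) rather than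
  \<open>+\<infinity>\<close>.  This makes no difference: \<open>f\<close> is then constant on the ball of radius \<open>\<delta>\<close> around the
  minimizer \<open>xbar\<close>, so that every point of the ball has distance \<open>0\<close> to the minimizers.\<close>

definition near_solution ::
  "nat \<Rightarrow> (real vec \<Rightarrow> real) \<Rightarrow> real vec \<Rightarrow> real \<Rightarrow> real \<Rightarrow> real \<Rightarrow> real \<Rightarrow> real \<Rightarrow> real \<Rightarrow> real vec \<Rightarrow> bool"
where
  "near_solution d f xbar \<delta> \<mu> Cb \<eta> L Cs x \<longleftrightarrow>
     x \<in> carrier_vec d \<and> enorm (x - xbar) < \<delta> / 4 \<and>
     edist_set x (argmin_set d f) \<le>
       min ((\<mu> / (2 * Cb)) powr (1 / \<eta>)) ((\<mu> powr (1 - \<eta>) / (L * Cs)) powr (1 / \<eta>))"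

section \<open>The Moore--Penrose pseudoinverse and \<open>PolyakBundle\<close>\<close>

definition is_pinv :: "real mat \<Rightarrow> real mat \<Rightarrow> bool" where
  "is_pinv A X \<longleftrightarrow> X \<in> carrier_mat (dim_col A) (dim_row A) \<and>
     A * X * A = A \<and> X * A * X = X \<and>
     transpose_mat (A * X) = A * X \<and> transpose_mat (X * A) = X * A"

definition pinv :: "real mat \<Rightarrow> real mat" where
  "pinv A = (THE X. is_pinv A X)"

definition bundle_mat :: "nat \<Rightarrow> (nat \<Rightarrow> real vec) \<Rightarrow> nat \<Rightarrow> real mat" where
  "bundle_mat d vs i = mat_of_rows d (map vs [0..<i])"

definition bundle_rhs ::
  "nat \<Rightarrow> (real vec \<Rightarrow> real) \<Rightarrow> (nat \<Rightarrow> real vec) \<Rightarrow> (nat \<Rightarrow> real vec) \<Rightarrow> nat \<Rightarrow> real vec" where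
  "bundle_rhs d f ys vs i =
     vec i (\<lambda>j. f (ys j) - min_val d f + vs j \<bullet> (ys 0 - ys j))"

definition bundle_run ::
  "nat \<Rightarrow> (real vec \<Rightarrow> real) \<Rightarrow> (real vec \<Rightarrow> real vec set) \<Rightarrow> real vec \<Rightarrow>
   (nat \<Rightarrow> real vec) \<Rightarrow> (nat \<Rightarrow> real vec) \<Rightarrow> bool" where
  "bundle_run d f g x ys vs \<longleftrightarrow>
     ys 0 = x \<and> (\<forall>i\<le>d. vs i \<in> g (ys i)) \<and>
     (\<forall>i\<in>{1..d}. ys i = ys 0 - pinv (bundle_mat d vs i) *\<^sub>v bundle_rhs d f ys vs i)"

definition bundle_candidates ::
  "nat \<Rightarrow> (real vec \<Rightarrow> real) \<Rightarrow> real \<Rightarrow> (nat \<Rightarrow> real vec) \<Rightarrow> nat set" where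
  "bundle_candidates d f \<tau> ys =
     {i \<in> {1..d}. enorm (ys i - ys 0) \<le> \<tau> * (f (ys 0) - min_val d f)}"

text \<open>The procedure is nondeterministic (choice of the \<open>v\<^sub>i\<close>, ties in the choice of \<open>s\<close>), so it
  denotes the set of its possible outputs; \<^const>\<open>None\<close> is the output \<open>\<emptyset>\<close>.\<close>

definition PolyakBundle ::
  "nat \<Rightarrow> (real vec \<Rightarrow> real) \<Rightarrow> (real vec \<Rightarrow> real vec set) \<Rightarrow> real vec \<Rightarrow> real \<Rightarrow> real vec option set"
where
  "PolyakBundle d f g x \<tau> =
     {r. \<exists>ys vs. bundle_run d f g x ys vs \<and>
        (let I = bundle_candidates d f \<tau> ys in
           (I = {} \<and> r = None) \<or>
           (\<exists>s\<in>I. (\<forall>i\<in>I. f (ys s) \<le> f (ys i)) \<and> r = Some (ys s)))}"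

section \<open>Methods and their flop count\<close>

text \<open>A method is one fixed program, the same for all dimensions and all problem data, over
  two-dimensional arrays of reals (addressed by an array name, a row and a column) and
  natural-number index registers.  Real values only arise from the inputs, integer literals, the
  oracles and arithmetic instructions; each arithmetic instruction costs one flop.  A comparison
  of reals is charged one flop as well, which only makes an upper bound on the flop count
  stronger.  Index arithmetic, control flow, data movement and oracle calls are free.

  Division by zero and square roots of negative numbers have their HOL values; since a program
  could test for these cases at the cost of one flop, nothing is gained from them.\<close>

datatype iexp = IConst nat | IReg nat | IAdd iexp iexp

text \<open>Array name, row, column.\<close>
datatype loc = Loc nat iexp iexp

datatype arith_op = Add | Sub | Mul | Div

datatype com =
    Skip
  | Seq com com
  | SetI nat iexp
  | Lit loc int
  | Copy loc loc
  | Arith arith_op loc loc loc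
  | Sqrt loc loc
  | IfLe loc loc com com
  | IfIdxLe iexp iexp com com
  | For nat iexp com
  | EvalF loc nat iexp
  | EvalG nat iexp nat iexp

record state =
  idx :: "nat \<Rightarrow> nat"
  mem :: "nat \<Rightarrow> nat \<Rightarrow> nat \<Rightarrow> real"
  queries :: nat
  flops :: nat

primrec ival :: "iexp \<Rightarrow> state \<Rightarrow> nat" where
  "ival (IConst n) s = n"
| "ival (IReg r) s = idx s r"
| "ival (IAdd e1 e2) s = ival e1 s + ival e2 s"

primrec rd :: "loc \<Rightarrow> state \<Rightarrow> real" where
  "rd (Loc a i j) s = mem s a (ival i s) (ival j s)"

definition put :: "nat \<Rightarrow> nat \<Rightarrow> nat \<Rightarrow> real \<Rightarrow> state \<Rightarrow> state" where
  "put a i j v s = s\<lparr>mem := (mem s)(a := (mem s a)(i := (mem s a i)(j := v)))\<rparr>"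

primrec wr :: "loc \<Rightarrow> real \<Rightarrow> state \<Rightarrow> state" where
  "wr (Loc a i j) v s = put a (ival i s) (ival j s) v s"

definition set_idx :: "nat \<Rightarrow> nat \<Rightarrow> state \<Rightarrow> state" where
  "set_idx r n s = s\<lparr>idx := (idx s)(r := n)\<rparr>"

definition tick :: "state \<Rightarrow> state" where
  "tick s = s\<lparr>flops := Suc (flops s)\<rparr>"

primrec arith_val :: "arith_op \<Rightarrow> real \<Rightarrow> real \<Rightarrow> real" where
  "arith_val Add a b = a + b"
| "arith_val Sub a b = a - b"
| "arith_val Mul a b = a * b"
| "arith_val Div a b = a / b"

definition row_vec :: "nat \<Rightarrow> nat \<Rightarrow> nat \<Rightarrow> state \<Rightarrow> real vec" where
  "row_vec d a i s = vec d (\<lambda>j. mem s a i j)"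

definition put_row :: "nat \<Rightarrow> nat \<Rightarrow> nat \<Rightarrow> real vec \<Rightarrow> state \<Rightarrow> state" where
  "put_row d a i v s =
     s\<lparr>mem := (mem s)(a := (mem s a)(i := (\<lambda>j. if j < d then v $ j else mem s a i j)))\<rparr>"

text \<open>\<open>\<gamma> k y\<close> is the answer of the oracle for \<open>g\<close> if the \<open>k\<close>-th query is at \<open>y\<close>.  Letting it
  depend on \<open>k\<close> allows different answers to repeated queries at the same point.\<close>

primrec exec ::
  "nat \<Rightarrow> (real vec \<Rightarrow> real) \<Rightarrow> (nat \<Rightarrow> real vec \<Rightarrow> real vec) \<Rightarrow> com \<Rightarrow> state \<Rightarrow> state" where
  "exec d f \<gamma> Skip = (\<lambda>s. s)"
| "exec d f \<gamma> (Seq c1 c2) = (\<lambda>s. exec d f \<gamma> c2 (exec d f \<gamma> c1 s))"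
| "exec d f \<gamma> (SetI r e) = (\<lambda>s. set_idx r (ival e s) s)"
| "exec d f \<gamma> (Lit l n) = (\<lambda>s. wr l (of_int n) s)"
| "exec d f \<gamma> (Copy l l1) = (\<lambda>s. wr l (rd l1 s) s)"
| "exec d f \<gamma> (Arith p l l1 l2) = (\<lambda>s. tick (wr l (arith_val p (rd l1 s) (rd l2 s)) s))"
| "exec d f \<gamma> (Sqrt l l1) = (\<lambda>s. tick (wr l (sqrt (rd l1 s)) s))"
| "exec d f \<gamma> (IfLe l1 l2 c1 c2) =
     (\<lambda>s. if rd l1 s \<le> rd l2 s then exec d f \<gamma> c1 (tick s) else exec d f \<gamma> c2 (tick s))"
| "exec d f \<gamma> (IfIdxLe e1 e2 c1 c2) =
     (\<lambda>s. if ival e1 s \<le> ival e2 s then exec d f \<gamma> c1 s else exec d f \<gamma> c2 s)"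
| "exec d f \<gamma> (For r e c) =
     (\<lambda>s. fold (\<lambda>k t. exec d f \<gamma> c (set_idx r k t)) [0..<ival e s] s)"
| "exec d f \<gamma> (EvalF l a i) = (\<lambda>s. wr l (f (row_vec d a (ival i s) s)) s)"
| "exec d f \<gamma> (EvalG b k a i) =
     (\<lambda>s. put_row d b (ival k s) (\<gamma> (queries s) (row_vec d a (ival i s) s))
            (s\<lparr>queries := Suc (queries s)\<rparr>))"

text \<open>Inputs: \<open>d\<close> in index register \<open>0\<close>, the point \<open>x\<close> in row \<open>0\<close> of array \<open>0\<close>, and the scalars
  \<open>f\<^sup>*\<close> and \<open>\<tau>\<close> in row \<open>0\<close> of array \<open>1\<close>.  Output: row \<open>0\<close> of array \<open>2\<close>.\<close>

definition init_state :: "nat \<Rightarrow> real \<Rightarrow> real \<Rightarrow> real vec \<Rightarrow> state" where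
  "init_state d fstar \<tau> x =
     \<lparr>idx = (\<lambda>r. if r = 0 then d else 0),
      mem = (\<lambda>a i j. if a = 0 \<and> i = 0 \<and> j < d then x $ j
                     else if a = 1 \<and> i = 0 \<and> j = 0 then fstar
                     else if a = 1 \<and> i = 0 \<and> j = 1 then \<tau>
                     else 0),
      queries = 0, flops = 0\<rparr>"

definition method_out :: "nat \<Rightarrow> state \<Rightarrow> real vec" where
  "method_out d s = row_vec d 2 0 s"

definition run_method ::
  "com \<Rightarrow> nat \<Rightarrow> (real vec \<Rightarrow> real) \<Rightarrow> (nat \<Rightarrow> real vec \<Rightarrow> real vec) \<Rightarrow> real \<Rightarrow> real vec \<Rightarrow> state" where
  "run_method M d f \<gamma> \<tau> x = exec d f \<gamma> M (init_state d (min_val d f) \<tau> x)"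

end

theory Submission
  imports Defs
begin

text \<open>Computing the pseudoinverses of the \<open>d\<close> matrices \<open>A\<^sub>i\<close> one by one would cost more than \<open>d\<^sup>3\<close> flops,
but \<open>A\<^sub>i\<^sub>+\<^sub>1\<close> is \<open>A\<^sub>i\<close> with one row appended.  Greville's recursion updates the pseudoinverse under
this operation with a few matrix-vector products and one rank-one correction, that is, with
\<open>O(d\<^sup>2)\<close> flops.  It distinguishes whether the new row lies in the span of the old ones, a question
that a comparison answers in exact arithmetic, and so handles linearly dependent subgradients,
where the linear system may be inconsistent and \<open>A\<^sub>i\<^sup>\<dagger>\<close> yields the least squares solution of
minimal norm.  The recursion is lemma \<open>is_pinv_add_row\<close>.

Given the pseudoinverse, the next point is one more matrix-vector product, and evaluating the
right-hand side, the distance \<open>\<parallel>y\<^sub>i - y\<^sub>0\<parallel>\<close> and the running best candidate takes \<open>O(d)\<close> flops.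
With \<open>d\<close> steps the total is \<open>O(d\<^sup>3)\<close>.  In the program this is visible syntactically: all loops
run over \<open>{..<d}\<close> and are nested at most three deep, so the flop count is at most the number of
arithmetic instructions in the program text times \<open>d\<^sup>3\<close> (lemma \<open>exec_flops\<close>).

The correctness of the program is an invariant of its main loop (\<open>loop_inv\<close>): after \<open>k\<close> steps the
arrays hold the first \<open>k\<close> steps of a run of the procedure, the current pseudoinverse and the best
candidate so far.  The program thus produces an output of the procedure as soon as its run has
a candidate at all, and the hypothesis on the constant \<open>Cs\<close> excludes the output \<open>\<emptyset>\<close>.\<close>

section \<open>The pseudoinverse of a matrix with an appended row\<close>
definition add_row :: "real mat \<Rightarrow> real vec \<Rightarrow> real mat" where
  "add_row A a = mat (Suc (dim_row A)) (dim_col A) (\<lambda>(i, j). if i < dim_row A then A $$ (i, j) else a $ j)"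

definition add_col :: "real mat \<Rightarrow> real vec \<Rightarrow> real mat" where
  "add_col A b = mat (dim_row A) (Suc (dim_col A)) (\<lambda>(i, j). if j < dim_col A then A $$ (i, j) else b $ i)"

definition outer :: "real vec \<Rightarrow> real vec \<Rightarrow> real mat" where
  "outer b a = mat (dim_vec b) (dim_vec a) (\<lambda>(i, j). b $ i * a $ j)"

text \<open>Both \<open>A X\<close> and \<open>A Y\<close> are the orthogonal projection onto the column space of \<open>A\<close>, and both \<open>X A\<close>
and \<open>Y A\<close> the one onto its row space; \<open>X\<close> is determined by the two, since \<open>X = X A X\<close>.\<close>
lemma is_pinv_unique:
  assumes X: "is_pinv A X" and Y: "is_pinv A Y"
  shows "X = Y"
proof -
  obtain m n where A: "A \<in> carrier_mat m n" by blast
  have cX: "X \<in> carrier_mat n m" and cY: "Y \<in> carrier_mat n m"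
    using X Y A by (auto simp: is_pinv_def)
  have AX: "A * X \<in> carrier_mat m m" and AY: "A * Y \<in> carrier_mat m m"
    and XA: "X * A \<in> carrier_mat n n" and YA: "Y * A \<in> carrier_mat n n"
    using A cX cY by auto
  have eqs: "A * X * A = A" "A * Y * A = A" "X * A * X = X" "Y * A * Y = Y"
      "transpose_mat (A * X) = A * X" "transpose_mat (A * Y) = A * Y"
      "transpose_mat (X * A) = X * A" "transpose_mat (Y * A) = Y * A"
    using X Y by (auto simp: is_pinv_def)
  have "A * X = (A * Y) * (A * X)"
    using assoc_mult_mat[OF AY A cX] eqs(2) by simp
  also have "\<dots> = transpose_mat ((A * X) * (A * Y))"
    using transpose_mult[OF AX AY] eqs(5,6) by simp
  also have "(A * X) * (A * Y) = A * Y"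
    using assoc_mult_mat[OF AX A cY] eqs(1) by simp
  finally have l: "A * X = A * Y" using eqs(6) by simp
  have "X * A = (X * A) * (Y * A)"
    using assoc_mult_mat[OF XA cY A] assoc_mult_mat[OF cX A cY] assoc_mult_mat[OF cX AY A] eqs(2)
    by simp
  also have "\<dots> = transpose_mat ((Y * A) * (X * A))"
    using transpose_mult[OF YA XA] eqs(7,8) by simp
  also have "(Y * A) * (X * A) = Y * A"
    using assoc_mult_mat[OF YA cX A] assoc_mult_mat[OF cY A cX] assoc_mult_mat[OF cY AX A] eqs(1)
    by simp
  finally have r: "X * A = Y * A" using eqs(8) by simp
  have "X = X * A * Y"
    using assoc_mult_mat[OF cX A cX] assoc_mult_mat[OF cX A cY] eqs(3) l by simp
  then show ?thesis using r eqs(4) by simp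
qed

lemma pinv_eqI: "is_pinv A X \<Longrightarrow> pinv A = X"
  unfolding pinv_def by (rule the_equality) (auto dest: is_pinv_unique)

lemma outer_carrier [simp]: "b \<in> carrier_vec n \<Longrightarrow> a \<in> carrier_vec m \<Longrightarrow> outer b a \<in> carrier_mat n m"
  by (auto simp: outer_def)

lemma add_row_carrier: "A \<in> carrier_mat k n \<Longrightarrow> add_row A a \<in> carrier_mat (Suc k) n"
  by (auto simp: add_row_def)

lemma add_col_carrier: "A \<in> carrier_mat n k \<Longrightarrow> add_col A b \<in> carrier_mat n (Suc k)"
  by (auto simp: add_col_def)

lemma outer_mult_vec:
  "a \<in> carrier_vec m \<Longrightarrow> x \<in> carrier_vec m \<Longrightarrow> outer b a *\<^sub>v x = (a \<bullet> x) \<cdot>\<^sub>v b"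
  by (intro eq_vecI) (auto simp: outer_def scalar_prod_def sum_distrib_left sum_distrib_right mult_ac)

lemma mult_outer:
  "A \<in> carrier_mat k n \<Longrightarrow> b \<in> carrier_vec n \<Longrightarrow> A * outer b a = outer (A *\<^sub>v b) a"
  by (intro eq_matI) (auto simp: outer_def scalar_prod_def sum_distrib_left sum_distrib_right mult_ac)

lemma outer_mult:
  "A \<in> carrier_mat k n \<Longrightarrow> a \<in> carrier_vec k \<Longrightarrow> outer b a * A = outer b (transpose_mat A *\<^sub>v a)"
  by (intro eq_matI) (auto simp: outer_def scalar_prod_def sum_distrib_left sum_distrib_right mult_ac)

lemma transpose_outer: "transpose_mat (outer b a) = outer a b"
  by (intro eq_matI) (auto simp: outer_def)

lemma outer_zero:
  "v \<in> carrier_vec n \<Longrightarrow> outer (0\<^sub>v m) v = 0\<^sub>m m n"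
  "v \<in> carrier_vec n \<Longrightarrow> outer v (0\<^sub>v m) = 0\<^sub>m n m"
  by (auto simp: outer_def intro!: eq_matI)

lemma outer_smult:
  "outer (r \<cdot>\<^sub>v v) w = r \<cdot>\<^sub>m outer v w" "outer v (r \<cdot>\<^sub>v w) = r \<cdot>\<^sub>m outer v w"
  by (auto simp: outer_def)

lemma outer_minus_right:
  "v \<in> carrier_vec n \<Longrightarrow> w \<in> carrier_vec n \<Longrightarrow> outer b (v - w) = outer b v - outer b w"
  by (auto simp: outer_def algebra_simps intro!: eq_matI)

lemma diff_add_mat:
  fixes A :: "real mat"
  shows "A \<in> carrier_mat n m \<Longrightarrow> B \<in> carrier_mat n m \<Longrightarrow> C \<in> carrier_mat n m \<Longrightarrow>
    (A - B) + C = A + (C - B)"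
  by (intro eq_matI) auto

lemma add_diff_cancel_vec:
  fixes v :: "real vec"
  shows "v \<in> carrier_vec n \<Longrightarrow> w \<in> carrier_vec n \<Longrightarrow> v + (w - v) = w"
  by (intro eq_vecI) auto

lemma add_row_mult:
  "A \<in> carrier_mat k n \<Longrightarrow> a \<in> carrier_vec n \<Longrightarrow> W \<in> carrier_mat n m \<Longrightarrow>
   add_row A a * W = add_row (A * W) (transpose_mat W *\<^sub>v a)"
  by (intro eq_matI) (auto simp: add_row_def scalar_prod_def less_Suc_eq mult_ac)

lemma mult_add_col:
  "Z \<in> carrier_mat n k \<Longrightarrow> b \<in> carrier_vec n \<Longrightarrow> W \<in> carrier_mat m n \<Longrightarrow>
   W * add_col Z b = add_col (W * Z) (W *\<^sub>v b)"
  by (intro eq_matI) (auto simp: add_col_def scalar_prod_def less_Suc_eq mult_ac)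

lemma add_col_mult_add_row:
  "Z \<in> carrier_mat n k \<Longrightarrow> b \<in> carrier_vec n \<Longrightarrow> A \<in> carrier_mat k m \<Longrightarrow> a \<in> carrier_vec m \<Longrightarrow>
   add_col Z b * add_row A a = Z * A + outer b a"
  by (intro eq_matI) (auto simp: add_col_def add_row_def outer_def scalar_prod_def)

text \<open>The two assumptions compare the diagonal and the off-diagonal blocks of the product with those
of its transpose.\<close>
lemma add_row_mult_add_col_symmetric:
  assumes A: "A \<in> carrier_mat k n" and a: "a \<in> carrier_vec n"
    and Z: "Z \<in> carrier_mat n k" and b: "b \<in> carrier_vec n"
    and sym: "transpose_mat (A * Z) = A * Z" and off: "A *\<^sub>v b = transpose_mat Z *\<^sub>v a"
  shows "transpose_mat (add_row A a * add_col Z b) = add_row A a * add_col Z b"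
proof -
  have *: "(A * Z) $$ (i, j) = (A * Z) $$ (j, i)" if "i < k" "j < k" for i j
    using that A Z arg_cong[OF sym, of "\<lambda>M. M $$ (j, i)"] by simp
  have **: "row A i \<bullet> b = a \<bullet> col Z i" if "i < k" for i
    using that A Z a arg_cong[OF off, of "\<lambda>v. v $ i"] comm_scalar_prod[OF a, of "col Z i"] by simp
  have "(add_row A a * add_col Z b) $$ (i, j) =
      (if i < k then if j < k then (A * Z) $$ (i, j) else row A i \<bullet> b
       else if j < k then a \<bullet> col Z j else a \<bullet> b)" if "i < Suc k" "j < Suc k" for i j
    using that A Z a b by (auto simp: add_row_def add_col_def scalar_prod_def)
  with * ** add_row_carrier[OF A, of a] add_col_carrier[OF Z, of b]
  show ?thesis by (intro eq_matI) auto
qed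

text \<open>The column that a new row \<open>a\<close> contributes to the pseudoinverse.  Here \<open>c\<close> is the component of
\<open>a\<close> orthogonal to the old row space and \<open>\<delta>\<close> holds the coefficients of the remaining part
\<open>A\<^sup>T \<delta>\<close>.  The test \<open>c \<bullet> c \<le> 0\<close> stands for \<open>c = 0\<close> and is the one that a program can make
with a single comparison.\<close>
definition greville_col :: "real mat \<Rightarrow> real vec \<Rightarrow> real vec \<Rightarrow> real vec" where
  "greville_col X \<delta> c =
     (if c \<bullet> c \<le> 0 then (1 / (1 + \<delta> \<bullet> \<delta>)) \<cdot>\<^sub>v (X *\<^sub>v \<delta>) else (1 / (c \<bullet> c)) \<cdot>\<^sub>v c)"

lemma scalar_prod_self_le_0:
  fixes c :: "real vec"
  assumes "c \<in> carrier_vec n" "c \<bullet> c \<le> 0"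
  shows "c = 0\<^sub>v n"
proof -
  have "c \<bullet> c = (\<Sum>i<n. c $ i * c $ i)"
    using assms(1) by (simp add: scalar_prod_def lessThan_atLeast0)
  with assms(2) have "(\<Sum>i<n. c $ i * c $ i) = 0"
    by (simp add: order_antisym sum_nonneg)
  then have "\<forall>i<n. c $ i = 0" by (subst (asm) sum_nonneg_eq_0_iff) auto
  then show ?thesis using assms(1) by auto
qed

text \<open>Greville's recursion.  Write \<open>A'\<close> and \<open>X'\<close> for the two extended matrices.  Because
\<open>a = A\<^sup>T \<delta> + c\<close>, the product \<open>X' A'\<close> collapses to \<open>X A + b c\<^sup>T\<close>: the projection onto the old
row space plus a term that vanishes if \<open>c = 0\<close> and is the projection onto the new direction
otherwise.  On the other side \<open>A b = (1 - a \<bullet> b) \<delta>\<close> in both cases, which is exactly the symmetry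
of the off-diagonal blocks of \<open>A' X'\<close>.\<close>
lemma is_pinv_add_row:
  assumes A: "A \<in> carrier_mat k n" and a: "a \<in> carrier_vec n" and X: "is_pinv A X"
    and \<delta>: "\<delta> = transpose_mat X *\<^sub>v a" and c: "c = a - transpose_mat A *\<^sub>v \<delta>"
    and b: "b = greville_col X \<delta> c"
  shows "is_pinv (add_row A a) (add_col (X - outer b \<delta>) b)"
proof -
  let ?A' = "add_row A a" and ?Z = "X - outer b \<delta>"
  let ?X' = "add_col ?Z b"
  have cX [simp]: "X \<in> carrier_mat n k" using X A by (auto simp: is_pinv_def)
  have AXA: "A * X * A = A" and XAX: "X * A * X = X"
    and symAX: "transpose_mat (A * X) = A * X" and symXA: "transpose_mat (X * A) = X * A"
    using X by (auto simp: is_pinv_def)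
  note [simp] = A a
  have [simp]: "\<delta> \<in> carrier_vec k" unfolding \<delta> by (rule mult_mat_vec_carrier[of _ _ n]) simp_all
  have At\<delta>c [simp]: "transpose_mat A *\<^sub>v \<delta> \<in> carrier_vec n" by (rule mult_mat_vec_carrier[of _ _ k]) simp_all
  have [simp]: "c \<in> carrier_vec n" unfolding c by simp
  have X\<delta>c [simp]: "X *\<^sub>v \<delta> \<in> carrier_vec n" by (rule mult_mat_vec_carrier[of _ _ k]) simp_all
  have [simp]: "b \<in> carrier_vec n" unfolding b greville_col_def by simp
  have [simp]: "?Z \<in> carrier_mat n k" by (rule minus_carrier_mat) simp
  have AXc [simp]: "A * X \<in> carrier_mat k k" and XAc [simp]: "X * A \<in> carrier_mat n n"
    using mult_carrier_mat[OF A cX] mult_carrier_mat[OF cX A] by auto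

  have assoc_v: "A *\<^sub>v (X *\<^sub>v v) = (A * X) *\<^sub>v v" if "v \<in> carrier_vec k" for v
    using that by (simp add: assoc_mult_mat_vec[OF A cX])
  have assoc_w: "X *\<^sub>v (A *\<^sub>v v) = (X * A) *\<^sub>v v" if "v \<in> carrier_vec n" for v
    using that by (simp add: assoc_mult_mat_vec[OF cX A])
  have At\<delta>: "transpose_mat A *\<^sub>v \<delta> = (X * A) *\<^sub>v a"
    unfolding \<delta> using transpose_mult[OF cX A] symXA
    by (subst assoc_mult_mat_vec[symmetric, of _ n k _ n]) auto
  have c_eq: "c = a - (X * A) *\<^sub>v a" using c At\<delta> by simp
  have XAa: "(X * A) *\<^sub>v a \<in> carrier_vec n" by (rule mult_mat_vec_carrier[OF XAc a])
  have "A *\<^sub>v ((X * A) *\<^sub>v a) = A *\<^sub>v a"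
    using assoc_mult_mat_vec[OF A XAc a] assoc_mult_mat[OF A cX A] AXA by metis
  then have Ac: "A *\<^sub>v c = 0\<^sub>v k"
    unfolding c_eq mult_minus_distrib_mat_vec[OF A a XAa]
    using mult_mat_vec_carrier[OF A a] by simp
  have AX\<delta>: "(A * X) *\<^sub>v \<delta> = \<delta>"
  proof -
    have "transpose_mat X = transpose_mat (X * (A * X))" using XAX assoc_mult_mat[OF cX A cX] by simp
    also have "\<dots> = (A * X) * transpose_mat X" using transpose_mult[OF cX AXc] symAX by simp
    finally show ?thesis unfolding \<delta>
      by (metis AXc a assoc_mult_mat_vec cX transpose_carrier_mat)
  qed
  have Xtc: "transpose_mat X *\<^sub>v c = 0\<^sub>v k"
  proof -
    have "transpose_mat X *\<^sub>v (transpose_mat A *\<^sub>v \<delta>) = transpose_mat (A * X) *\<^sub>v \<delta>"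
      using transpose_mult[OF A cX] by (subst assoc_mult_mat_vec[symmetric, of _ k n _ k]) auto
    then have "transpose_mat X *\<^sub>v (transpose_mat A *\<^sub>v \<delta>) = \<delta>" using symAX AX\<delta> by simp
    then show ?thesis unfolding c
      by (subst mult_minus_distrib_mat_vec[of _ k n]) (auto simp: \<delta>[symmetric])
  qed
  have tA: "(transpose_mat A *\<^sub>v \<delta>) \<bullet> v = \<delta> \<bullet> (A *\<^sub>v v)" if "v \<in> carrier_vec n" for v
    using transpose_vec_mult_scalar[OF A that, of \<delta>] by simp
  have ca: "c \<bullet> a = c \<bullet> c"
  proof -
    have "c \<bullet> (transpose_mat A *\<^sub>v \<delta>) = 0"
      using tA[of c] Ac comm_scalar_prod[OF At\<delta>c, of c] by simp
    moreover have "c \<bullet> c = c \<bullet> a - c \<bullet> (transpose_mat A *\<^sub>v \<delta>)"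
      by (subst (2) c, subst scalar_prod_minus_distrib[of _ n]) auto
    ultimately show ?thesis by simp
  qed

  \<comment> \<open>All that the rest of the proof needs to know about \<open>b\<close>, whichever case defines it.\<close>
  have "A *\<^sub>v b = (1 - a \<bullet> b) \<cdot>\<^sub>v \<delta> \<and> (c \<bullet> a) \<cdot>\<^sub>v b = c \<and> (X * A) *\<^sub>v b + (c \<bullet> b) \<cdot>\<^sub>v b = b
    \<and> outer (A *\<^sub>v b) c = 0\<^sub>m k n \<and> outer c b = outer b c \<and> outer \<delta> (A *\<^sub>v b) = outer (A *\<^sub>v b) \<delta>"
  proof (cases "c \<bullet> c \<le> 0")
    case True
    then have c0: "c = 0\<^sub>v n" by (intro scalar_prod_self_le_0) simp_all
    define r where "r = 1 / (1 + \<delta> \<bullet> \<delta>)"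
    have b': "b = r \<cdot>\<^sub>v (X *\<^sub>v \<delta>)" using True by (simp add: b greville_col_def r_def)
    have pos: "\<delta> \<bullet> \<delta> \<ge> 0" by (auto simp: scalar_prod_def intro: sum_nonneg)
    have Ab: "A *\<^sub>v b = r \<cdot>\<^sub>v \<delta>"
      unfolding b' by (subst mult_mat_vec[OF A]) (auto simp: assoc_v AX\<delta> simp del: assoc_mult_mat_vec)
    have "a = transpose_mat A *\<^sub>v \<delta>"
      using c c0 carrier_vecD[OF a] carrier_vecD[OF At\<delta>c] by (intro eq_vecI) (auto simp: vec_eq_iff)
    then have "a \<bullet> b = r * (\<delta> \<bullet> \<delta>)" using tA[of b] Ab by simp
    then have "1 - a \<bullet> b = r" using pos by (simp add: r_def field_simps)
    moreover have "(X * A) *\<^sub>v b = b"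
      unfolding assoc_mult_mat_vec[OF cX A \<open>b \<in> carrier_vec n\<close>] Ab
      by (subst mult_mat_vec[OF cX]) (simp_all add: b')
    moreover have "(0 \<cdot>\<^sub>v b) = 0\<^sub>v n" by (intro eq_vecI) (auto simp: carrier_vecD[OF \<open>b \<in> carrier_vec n\<close>])
    moreover have "outer (A *\<^sub>v b) c = 0\<^sub>m k n" "outer c b = outer b c"
      unfolding Ab c0 by (simp_all add: outer_zero[of _ k] outer_zero[of _ n])
    moreover have "outer \<delta> (A *\<^sub>v b) = outer (A *\<^sub>v b) \<delta>"
      unfolding Ab by (simp add: outer_smult)
    ultimately show ?thesis using Ab by (simp add: c0)
  next
    case False
    define r where "r = 1 / (c \<bullet> c)"
    have b': "b = r \<cdot>\<^sub>v c" using False by (simp add: b greville_col_def r_def)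
    have "a \<bullet> b = 1" using False ca comm_scalar_prod[of a n c] by (simp add: b' r_def scalar_prod_smult_distrib[of a n c])
    moreover have Ab0: "A *\<^sub>v b = 0\<^sub>v k" unfolding b' by (subst mult_mat_vec[OF A]) (auto simp: Ac)
    moreover have "c \<bullet> b = 1" using False by (simp add: b' r_def scalar_prod_smult_distrib[of c n c])
    moreover have "0 \<cdot>\<^sub>v \<delta> = 0\<^sub>v k" by (intro eq_vecI) (auto simp: carrier_vecD[OF \<open>\<delta> \<in> carrier_vec k\<close>])
    moreover have "(c \<bullet> a) \<cdot>\<^sub>v b = c" using False ca by (simp add: b' r_def smult_smult_assoc)
    moreover have "(X * A) *\<^sub>v b = 0\<^sub>v n"
      unfolding assoc_mult_mat_vec[OF cX A \<open>b \<in> carrier_vec n\<close>] Ab0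
      by (intro eq_vecI) (auto simp: scalar_prod_def carrier_matD[OF cX])
    moreover have "outer (A *\<^sub>v b) c = 0\<^sub>m k n" "outer \<delta> (A *\<^sub>v b) = outer (A *\<^sub>v b) \<delta>"
      unfolding Ab0 by (simp_all add: outer_zero[of _ k] outer_zero[of _ n])
    moreover have "outer c b = outer b c" unfolding b' by (simp add: outer_smult)
    ultimately show ?thesis by simp
  qed
  then have Ab: "A *\<^sub>v b = (1 - a \<bullet> b) \<cdot>\<^sub>v \<delta>" and cab: "(c \<bullet> a) \<cdot>\<^sub>v b = c"
    and fixb: "(X * A) *\<^sub>v b + (c \<bullet> b) \<cdot>\<^sub>v b = b" and Abc: "outer (A *\<^sub>v b) c = 0\<^sub>m k n"
    and symbc: "outer c b = outer b c" and symAb: "outer \<delta> (A *\<^sub>v b) = outer (A *\<^sub>v b) \<delta>" by blast+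

  have bc [simp]: "outer b c \<in> carrier_mat n n" and b\<delta> [simp]: "outer b \<delta> \<in> carrier_mat n k" by simp_all
  \<comment> \<open>\<open>W\<close> is the orthogonal projection onto the extended row space.\<close>
  define W where "W = X * A + outer b c"
  have Wc [simp]: "W \<in> carrier_mat n n" by (simp add: W_def)
  have W: "?X' * ?A' = W"
  proof -
    have "?X' * ?A' = (X - outer b \<delta>) * A + outer b a" by (rule add_col_mult_add_row[of _ n k _ _ n]) simp_all
    also have "\<dots> = (X * A - outer b (transpose_mat A *\<^sub>v \<delta>)) + outer b a"
      by (subst minus_mult_distrib_mat[OF cX b\<delta> A]) (simp add: outer_mult[OF A])
    also have "\<dots> = X * A + (outer b a - outer b (transpose_mat A *\<^sub>v \<delta>))"
      by (rule diff_add_mat[OF XAc outer_carrier[OF \<open>b \<in> _\<close> At\<delta>c] outer_carrier[OF \<open>b \<in> _\<close> a]])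
    also have "\<dots> = W" unfolding W_def c outer_minus_right[OF a At\<delta>c] ..
    finally show ?thesis .
  qed
  have symW: "transpose_mat W = W"
    unfolding W_def by (subst transpose_add[of _ n n]) (auto simp: symXA transpose_outer symbc)
  have W_vec: "W *\<^sub>v v = (X * A) *\<^sub>v v + (c \<bullet> v) \<cdot>\<^sub>v b" if "v \<in> carrier_vec n" for v
    unfolding W_def add_mult_distrib_mat_vec[OF XAc bc that] outer_mult_vec[OF \<open>c \<in> _\<close> that] ..
  have Wa: "W *\<^sub>v a = a"
  proof -
    have "W *\<^sub>v a = (X * A) *\<^sub>v a + (a - (X * A) *\<^sub>v a)"
      using W_vec[OF a] cab c_eq by simp
    also have "\<dots> = a" by (rule add_diff_cancel_vec[OF XAa a])
    finally show ?thesis .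
  qed
  have AW: "A * W = A"
    unfolding W_def mult_add_distrib_mat[OF A XAc bc] mult_outer[OF A \<open>b \<in> _\<close>] Abc
      assoc_mult_mat[OF A cX A, symmetric] AXA by simp
  have Wb: "W *\<^sub>v b = b" using W_vec[OF \<open>b \<in> _\<close>] fixb by simp
  have WX: "W * X = X"
    unfolding W_def add_mult_distrib_mat[OF XAc bc cX] outer_mult[OF cX \<open>c \<in> _\<close>] Xtc XAX
      outer_zero(2)[OF \<open>b \<in> _\<close>] by simp
  have WZ: "W * ?Z = ?Z"
    unfolding mult_minus_distrib_mat[OF Wc cX b\<delta>] mult_outer[OF Wc \<open>b \<in> _\<close>] WX Wb ..
  have A'c: "?A' \<in> carrier_mat (Suc k) n" and X'c: "?X' \<in> carrier_mat n (Suc k)"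
    by (auto intro: add_row_carrier add_col_carrier)
  have 1: "?A' * ?X' * ?A' = ?A'"
    using assoc_mult_mat[OF A'c X'c A'c] W add_row_mult[OF A a Wc] AW symW Wa by simp
  have 2: "?X' * ?A' * ?X' = ?X'"
    using W mult_add_col[OF \<open>?Z \<in> _\<close> \<open>b \<in> _\<close> Wc] WZ Wb by simp
  have AZ: "A * ?Z = A * X - outer (A *\<^sub>v b) \<delta>"
    unfolding mult_minus_distrib_mat[OF A cX b\<delta>] mult_outer[OF A \<open>b \<in> _\<close>] ..
  have Abc': "outer (A *\<^sub>v b) \<delta> \<in> carrier_mat k k"
    by (intro outer_carrier mult_mat_vec_carrier[of A k n]) simp_all
  have 3: "transpose_mat (?A' * ?X') = ?A' * ?X'"
  proof (rule add_row_mult_add_col_symmetric[OF A a])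
    show "transpose_mat (A * ?Z) = A * ?Z"
      unfolding AZ transpose_minus[OF AXc Abc'] transpose_outer symAX symAb ..
    have "transpose_mat ?Z *\<^sub>v a = \<delta> - (b \<bullet> a) \<cdot>\<^sub>v \<delta>"
      unfolding transpose_minus[OF cX b\<delta>] transpose_outer
      using minus_mult_distrib_mat_vec[of "transpose_mat X" k n "outer \<delta> b" a]
      by (simp add: \<delta>[symmetric] outer_mult_vec[of b n])
    then show "A *\<^sub>v b = transpose_mat ?Z *\<^sub>v a"
      unfolding Ab comm_scalar_prod[OF a \<open>b \<in> _\<close>] by (auto simp: algebra_simps)
  qed simp_all
  show ?thesis
    unfolding is_pinv_def using 1 2 3 A'c X'c W symW by simp
qed

section \<open>Effect and cost of programs\<close>

primrec iregs :: "iexp \<Rightarrow> nat set" where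
  "iregs (IConst n) = {}"
| "iregs (IReg r) = {r}"
| "iregs (IAdd e1 e2) = iregs e1 \<union> iregs e2"

primrec loc_regs :: "loc \<Rightarrow> nat set" where
  "loc_regs (Loc a i j) = iregs i \<union> iregs j"

primrec loc_arr :: "loc \<Rightarrow> nat" where
  "loc_arr (Loc a i j) = a"

primrec written :: "com \<Rightarrow> nat set" where
  "written Skip = {}"
| "written (Seq c1 c2) = written c1 \<union> written c2"
| "written (SetI r e) = {}"
| "written (Lit l n) = {loc_arr l}"
| "written (Copy l l1) = {loc_arr l}"
| "written (Arith p l l1 l2) = {loc_arr l}"
| "written (Sqrt l l1) = {loc_arr l}"
| "written (IfLe l1 l2 c1 c2) = written c1 \<union> written c2"
| "written (IfIdxLe e1 e2 c1 c2) = written c1 \<union> written c2"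
| "written (For r e c) = written c"
| "written (EvalF l a i) = {loc_arr l}"
| "written (EvalG b k a i) = {b}"

primrec set_regs :: "com \<Rightarrow> nat set" where
  "set_regs Skip = {}"
| "set_regs (Seq c1 c2) = set_regs c1 \<union> set_regs c2"
| "set_regs (SetI r e) = {r}"
| "set_regs (Lit l n) = {}"
| "set_regs (Copy l l1) = {}"
| "set_regs (Arith p l l1 l2) = {}"
| "set_regs (Sqrt l l1) = {}"
| "set_regs (IfLe l1 l2 c1 c2) = set_regs c1 \<union> set_regs c2"
| "set_regs (IfIdxLe e1 e2 c1 c2) = set_regs c1 \<union> set_regs c2"
| "set_regs (For r e c) = insert r (set_regs c)"
| "set_regs (EvalF l a i) = {}"
| "set_regs (EvalG b k a i) = {}"

primrec arith_count :: "com \<Rightarrow> nat" where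
  "arith_count Skip = 0"
| "arith_count (Seq c1 c2) = arith_count c1 + arith_count c2"
| "arith_count (SetI r e) = 0"
| "arith_count (Lit l n) = 0"
| "arith_count (Copy l l1) = 0"
| "arith_count (Arith p l l1 l2) = 1"
| "arith_count (Sqrt l l1) = 1"
| "arith_count (IfLe l1 l2 c1 c2) = 1 + arith_count c1 + arith_count c2"
| "arith_count (IfIdxLe e1 e2 c1 c2) = arith_count c1 + arith_count c2"
| "arith_count (For r e c) = arith_count c"
| "arith_count (EvalF l a i) = 0"
| "arith_count (EvalG b k a i) = 0"

primrec nesting :: "com \<Rightarrow> nat" where
  "nesting Skip = 0"
| "nesting (Seq c1 c2) = max (nesting c1) (nesting c2)"
| "nesting (SetI r e) = 0"
| "nesting (Lit l n) = 0"
| "nesting (Copy l l1) = 0"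
| "nesting (Arith p l l1 l2) = 0"
| "nesting (Sqrt l l1) = 0"
| "nesting (IfLe l1 l2 c1 c2) = max (nesting c1) (nesting c2)"
| "nesting (IfIdxLe e1 e2 c1 c2) = max (nesting c1) (nesting c2)"
| "nesting (For r e c) = Suc (nesting c)"
| "nesting (EvalF l a i) = 0"
| "nesting (EvalG b k a i) = 0"

text \<open>All loops run over the full dimension, which sits in register \<open>0\<close>.  Together with the nesting
depth this makes the flop bound a matter of syntax.\<close>
primrec dim_loops :: "com \<Rightarrow> bool" where
  "dim_loops Skip = True"
| "dim_loops (Seq c1 c2) = (dim_loops c1 \<and> dim_loops c2)"
| "dim_loops (SetI r e) = True"
| "dim_loops (Lit l n) = True"
| "dim_loops (Copy l l1) = True"
| "dim_loops (Arith p l l1 l2) = True"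
| "dim_loops (Sqrt l l1) = True"
| "dim_loops (IfLe l1 l2 c1 c2) = (dim_loops c1 \<and> dim_loops c2)"
| "dim_loops (IfIdxLe e1 e2 c1 c2) = (dim_loops c1 \<and> dim_loops c2)"
| "dim_loops (For r e c) = (e = IReg 0 \<and> dim_loops c)"
| "dim_loops (EvalF l a i) = True"
| "dim_loops (EvalG b k a i) = True"

lemma state_simps [simp]:
  "idx (tick s) = idx s" "mem (tick s) = mem s" "flops (tick s) = Suc (flops s)"
  "idx (set_idx r n s) = (idx s)(r := n)" "mem (set_idx r n s) = mem s" "flops (set_idx r n s) = flops s"
  "idx (put_row d b k v s) = idx s" "flops (put_row d b k v s) = flops s"
  "idx (wr l x s) = idx s" "flops (wr l x s) = flops s"
  by (cases l; simp add: tick_def set_idx_def put_row_def put_def)+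

lemma mem_wr [simp]:
  "mem (wr (Loc a i j) v s) =
     (mem s)(a := (mem s a)(ival i s := (mem s a (ival i s))(ival j s := v)))"
  by (simp add: put_def)

lemma mem_put_row [simp]:
  "mem (put_row d b k v s) =
     (mem s)(b := (mem s b)(k := (\<lambda>j. if j < d then v $ j else mem s b k j)))"
  by (simp add: put_row_def)

declare wr.simps [simp del]

text \<open>Every loop below is verified with this rule; the number of iterations is fixed when the loop is
entered, so the bound is evaluated in the initial state.\<close>
lemma for_rule:
  assumes "I 0 s"
    and "\<And>k t. k < ival e s \<Longrightarrow> I k t \<Longrightarrow> I (Suc k) (exec d f \<gamma> c (set_idx r k t))"
  shows "I (ival e s) (exec d f \<gamma> (For r e c) s)"
proof -
  have "n \<le> ival e s \<Longrightarrow> I n (fold (\<lambda>k t. exec d f \<gamma> c (set_idx r k t)) [0..<n] s)" for n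
    by (induction n) (use assms in auto)
  then show ?thesis by simp
qed

lemma exec_mem_other:
  "a \<notin> written c \<Longrightarrow> mem (exec d f \<gamma> c s) a = mem s a"
proof (induction c arbitrary: s)
  case (For r e c)
  show ?case
    by (rule for_rule[where I = "\<lambda>_ t. mem t a = mem s a"]) (use For in auto)
next
  case (Lit l n) then show ?case by (cases l) simp
next
  case (Copy l l1) then show ?case by (cases l) simp
next
  case (Arith p l l1 l2) then show ?case by (cases l) simp
next
  case (Sqrt l l1) then show ?case by (cases l) simp
next
  case (EvalF l a i) then show ?case by (cases l) simp
qed auto

lemma exec_idx_other:
  "r \<notin> set_regs c \<Longrightarrow> idx (exec d f \<gamma> c s) r = idx s r"
proof (induction c arbitrary: s)
  case (For r' e c)
  show ?case
    by (rule for_rule[where I = "\<lambda>_ t. idx t r = idx s r"]) (use For in auto)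
qed auto

lemma mult_power_weaken:
  fixes a n :: nat
  assumes "x \<le> y + a * n ^ k" "1 \<le> n" "k \<le> m"
  shows "x \<le> y + a * n ^ m"
  using assms(1) mult_le_mono2[OF power_increasing[OF assms(3,2)], of a] by linarith

text \<open>An instruction inside \<open>m\<close> loops is executed at most \<open>n ^ m\<close> times; as \<open>1 \<le> n\<close>, the exponent may
be raised to the maximal nesting depth for all instructions alike.\<close>
lemma exec_flops:
  assumes "dim_loops c" "0 \<notin> set_regs c" "idx s 0 = n" "1 \<le> n"
  shows "flops (exec d f \<gamma> c s) \<le> flops s + arith_count c * n ^ nesting c"
  using assms
proof (induction c arbitrary: s)
  case (Seq c1 c2)
  let ?s = "exec d f \<gamma> c1 s" and ?N = "n ^ nesting (Seq c1 c2)"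
  have "flops ?s \<le> flops s + arith_count c1 * ?N"
    by (rule mult_power_weaken[OF Seq.IH(1)]) (use Seq.prems in auto)
  moreover have "flops (exec d f \<gamma> c2 ?s) \<le> flops ?s + arith_count c2 * ?N"
    by (rule mult_power_weaken[OF Seq.IH(2)]) (use Seq.prems in \<open>auto simp: exec_idx_other\<close>)
  ultimately show ?case unfolding exec.simps arith_count.simps add_mult_distrib by linarith
next
  case (IfLe l1 l2 c1 c2)
  let ?N = "n ^ nesting (IfLe l1 l2 c1 c2)"
  have "flops (exec d f \<gamma> c1 (tick s)) \<le> flops (tick s) + arith_count c1 * ?N"
    by (rule mult_power_weaken[OF IfLe.IH(1)]) (use IfLe.prems in auto)
  moreover have "flops (exec d f \<gamma> c2 (tick s)) \<le> flops (tick s) + arith_count c2 * ?N"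
    by (rule mult_power_weaken[OF IfLe.IH(2)]) (use IfLe.prems in auto)
  moreover have "flops (tick s) = flops s + 1" by simp
  moreover have "1 \<le> ?N" using IfLe.prems(4) by (rule one_le_power)
  ultimately show ?case
    unfolding exec.simps arith_count.simps add_mult_distrib by (simp only: split: if_split) linarith
next
  case (IfIdxLe e1 e2 c1 c2)
  let ?N = "n ^ nesting (IfIdxLe e1 e2 c1 c2)"
  have "flops (exec d f \<gamma> c1 s) \<le> flops s + arith_count c1 * ?N"
    by (rule mult_power_weaken[OF IfIdxLe.IH(1)]) (use IfIdxLe.prems in auto)
  moreover have "flops (exec d f \<gamma> c2 s) \<le> flops s + arith_count c2 * ?N"
    by (rule mult_power_weaken[OF IfIdxLe.IH(2)]) (use IfIdxLe.prems in auto)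
  ultimately show ?case
    unfolding exec.simps arith_count.simps add_mult_distrib by (simp only: split: if_split) linarith
next
  case (For r e c)
  let ?B = "arith_count c * n ^ nesting c"
  let ?I = "\<lambda>k t. idx t 0 = n \<and> flops t \<le> flops s + k * ?B"
  have "?I (ival e s) (exec d f \<gamma> (For r e c) s)"
  proof (rule for_rule[where I = ?I], goal_cases)
    case (2 k t)
    have "flops (exec d f \<gamma> c (set_idx r k t)) \<le> flops (set_idx r k t) + ?B"
      by (rule For.IH) (use For.prems 2 in auto)
    with 2 For.prems show ?case by (simp add: exec_idx_other)
  qed (use For.prems in simp)
  then show ?case using For.prems by (simp add: mult_ac)
qed auto

section \<open>Compiling arithmetic expressions\<close>

text \<open>The program evaluates sums of products over array entries again and again.  It is written in
terms of expressions with a summation over \<open>{..<d}\<close>, which are compiled once and for all; an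
expression is then verified by unfolding its value.  The index of a sum is a register.\<close>
datatype rexp =
    Val loc
  | Num int
  | Op arith_op rexp rexp
  | Root rexp
  | Sum nat rexp

primrec reval :: "rexp \<Rightarrow> state \<Rightarrow> real" where
  "reval (Val l) s = rd l s"
| "reval (Num n) s = of_int n"
| "reval (Op p e1 e2) s = arith_val p (reval e1 s) (reval e2 s)"
| "reval (Root e) s = sqrt (reval e s)"
| "reval (Sum r e) s = (\<Sum>k<idx s 0. reval e (set_idx r k s))"

primrec free_regs :: "rexp \<Rightarrow> nat set" where
  "free_regs (Val l) = loc_regs l"
| "free_regs (Num n) = {}"
| "free_regs (Op p e1 e2) = free_regs e1 \<union> free_regs e2"
| "free_regs (Root e) = free_regs e"
| "free_regs (Sum r e) = insert 0 (free_regs e - {r})"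

primrec bound_regs :: "rexp \<Rightarrow> nat set" where
  "bound_regs (Val l) = {}"
| "bound_regs (Num n) = {}"
| "bound_regs (Op p e1 e2) = bound_regs e1 \<union> bound_regs e2"
| "bound_regs (Root e) = bound_regs e"
| "bound_regs (Sum r e) = insert r (bound_regs e)"

primrec read_arrs :: "rexp \<Rightarrow> nat set" where
  "read_arrs (Val l) = {loc_arr l}"
| "read_arrs (Num n) = {}"
| "read_arrs (Op p e1 e2) = read_arrs e1 \<union> read_arrs e2"
| "read_arrs (Root e) = read_arrs e"
| "read_arrs (Sum r e) = read_arrs e"

text \<open>Summation registers are overwritten and never restored, so that an operand evaluated later must
not read the ones of an operand evaluated earlier; and the dimension in register \<open>0\<close> has to
survive.\<close>
primrec well_scoped :: "rexp \<Rightarrow> bool" where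
  "well_scoped (Val l) = True"
| "well_scoped (Num n) = True"
| "well_scoped (Op p e1 e2) = (well_scoped e1 \<and> well_scoped e2 \<and> bound_regs e1 \<inter> free_regs e2 = {})"
| "well_scoped (Root e) = well_scoped e"
| "well_scoped (Sum r e) = (r \<noteq> 0 \<and> 0 \<notin> bound_regs e \<and> well_scoped e \<and> bound_regs e \<inter> free_regs e = {})"

abbreviation (input) "tmp_arr \<equiv> 7::nat"

abbreviation (input) tmp :: "nat \<Rightarrow> loc" where "tmp n \<equiv> Loc tmp_arr (IConst n) (IConst 0)"

text \<open>Row \<open>n\<close> of the temporary array receives the value; rows below \<open>n\<close> hold the pending operands of
enclosing expressions and stay intact.\<close>
primrec compile :: "nat \<Rightarrow> rexp \<Rightarrow> com" where
  "compile n (Val l) = Copy (tmp n) l"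
| "compile n (Num m) = Lit (tmp n) m"
| "compile n (Op p e1 e2) =
     Seq (compile n e1) (Seq (compile (Suc n) e2) (Arith p (tmp n) (tmp n) (tmp (Suc n))))"
| "compile n (Root e) = Seq (compile n e) (Sqrt (tmp n) (tmp n))"
| "compile n (Sum r e) =
     Seq (Lit (tmp n) 0)
       (For r (IReg 0) (Seq (compile (Suc n) e) (Arith Add (tmp n) (tmp n) (tmp (Suc n)))))"

lemma ival_cong: "(\<And>r. r \<in> iregs e \<Longrightarrow> idx s r = idx t r) \<Longrightarrow> ival e s = ival e t"
  by (induction e) auto

lemma rd_cong:
  "(\<And>r. r \<in> loc_regs l \<Longrightarrow> idx s r = idx t r) \<Longrightarrow> mem s (loc_arr l) = mem t (loc_arr l) \<Longrightarrow> rd l s = rd l t"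
  by (cases l) (auto cong: ival_cong)

lemma reval_cong:
  "(\<And>r. r \<in> free_regs e \<Longrightarrow> idx s r = idx t r) \<Longrightarrow> (\<And>a. a \<in> read_arrs e \<Longrightarrow> mem s a = mem t a) \<Longrightarrow>
   reval e s = reval e t"
proof (induction e arbitrary: s t)
  case (Val l) then show ?case by (auto intro: rd_cong)
next
  case (Op p e1 e2)
  have "reval e1 s = reval e1 t" by (rule Op.IH(1)) (use Op.prems in auto)
  moreover have "reval e2 s = reval e2 t" by (rule Op.IH(2)) (use Op.prems in auto)
  ultimately show ?case by simp
next
  case (Root e)
  have "reval e s = reval e t" by (rule Root.IH) (use Root.prems in auto)
  then show ?case by simp
next
  case (Sum r e)
  have "reval e (set_idx r k s) = reval e (set_idx r k t)" for k
    by (rule Sum.IH) (use Sum.prems in auto)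
  moreover have "idx s 0 = idx t 0" using Sum.prems by simp
  ultimately show ?case by simp
qed simp

lemma written_compile [simp]: "written (compile n e) = {tmp_arr}"
  by (induction e arbitrary: n) auto

lemma set_regs_compile [simp]: "set_regs (compile n e) = bound_regs e"
  by (induction e arbitrary: n) auto

lemma dim_loops_compile [simp]: "dim_loops (compile n e)"
  by (induction e arbitrary: n) auto

lemma compile_correct:
  assumes "well_scoped e" "tmp_arr \<notin> read_arrs e"
  shows "mem (exec d f \<gamma> (compile n e) s) tmp_arr n 0 = reval e s \<and>
    (\<forall>m<n. mem (exec d f \<gamma> (compile n e) s) tmp_arr m = mem s tmp_arr m)"
  using assms
proof (induction e arbitrary: n s)
  case (Op p e1 e2)
  let ?s = "exec d f \<gamma> (compile n e1) s"
  let ?t = "exec d f \<gamma> (compile (Suc n) e2) ?s"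
  have "reval e2 ?s = reval e2 s"
    by (rule reval_cong) (use Op.prems in \<open>auto simp: disjoint_iff intro!: exec_idx_other exec_mem_other\<close>)
  moreover have "mem ?s tmp_arr n 0 = reval e1 s \<and> (\<forall>m<n. mem ?s tmp_arr m = mem s tmp_arr m)"
    by (rule Op.IH) (use Op.prems in auto)
  moreover have "mem ?t tmp_arr (Suc n) 0 = reval e2 ?s \<and> (\<forall>m<Suc n. mem ?t tmp_arr m = mem ?s tmp_arr m)"
    by (rule Op.IH) (use Op.prems in auto)
  ultimately show ?case by (simp add: less_Suc_eq)
next
  case (Root e)
  then show ?case by simp
next
  case (Sum r e)
  let ?s = "exec d f \<gamma> (Lit (tmp n) 0) s"
  let ?c = "Seq (compile (Suc n) e) (Arith Add (tmp n) (tmp n) (tmp (Suc n)))"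
  let ?I = "\<lambda>k t. mem t tmp_arr n 0 = (\<Sum>j<k. reval e (set_idx r j s)) \<and>
    (\<forall>m<n. mem t tmp_arr m = mem s tmp_arr m) \<and> (\<forall>a. a \<noteq> tmp_arr \<longrightarrow> mem t a = mem s a) \<and>
    (\<forall>q. q \<notin> insert r (bound_regs e) \<longrightarrow> idx t q = idx s q)"
  have "?I (ival (IReg 0) ?s) (exec d f \<gamma> (For r (IReg 0) ?c) ?s)"
  proof (rule for_rule[where I = ?I], goal_cases)
    case (2 k t)
    let ?t = "exec d f \<gamma> (compile (Suc n) e) (set_idx r k t)"
    have reg: "idx (set_idx r k t) q = idx (set_idx r k s) q" if "q \<in> free_regs e" for q
      using Sum.prems(1) 2 that by (auto simp: disjoint_iff)
    have "a \<noteq> tmp_arr" if "a \<in> read_arrs e" for a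
      using Sum.prems(2) that by auto
    then have "mem (set_idx r k t) a = mem (set_idx r k s) a" if "a \<in> read_arrs e" for a
      using 2 that by simp
    with reg have "reval e (set_idx r k t) = reval e (set_idx r k s)"
      by (rule reval_cong)
    then have "mem ?t tmp_arr (Suc n) 0 = reval e (set_idx r k s) \<and> (\<forall>m<Suc n. mem ?t tmp_arr m = mem t tmp_arr m)"
      using Sum.IH[of "Suc n" "set_idx r k t"] Sum.prems by auto
    with 2 show ?case by (auto simp: exec_mem_other exec_idx_other)
  qed auto
  then show ?case by simp
qed auto

definition assign :: "loc \<Rightarrow> rexp \<Rightarrow> com" where
  "assign l e = Seq (compile 0 e) (Copy l (tmp 0))"

lemma assign_simps [simp]:
  "written (assign l e) = {tmp_arr, loc_arr l}" "set_regs (assign l e) = bound_regs e"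
  "dim_loops (assign l e)"
  by (auto simp: assign_def)

lemma mem_assign:
  assumes "well_scoped e" "tmp_arr \<notin> read_arrs e" "bound_regs e \<inter> (iregs i \<union> iregs j) = {}" "a \<noteq> tmp_arr"
  shows "mem (exec d f \<gamma> (assign (Loc a i j) e) s) a =
     (mem s a)(ival i s := (mem s a (ival i s))(ival j s := reval e s))"
proof -
  let ?s = "exec d f \<gamma> (compile 0 e) s"
  have "ival i ?s = ival i s" "ival j ?s = ival j s"
    using assms(3) by (auto simp: disjoint_iff intro!: ival_cong exec_idx_other)
  then show ?thesis
    using compile_correct[OF assms(1,2), of d f \<gamma> 0 s] assms(4)
    by (simp add: assign_def exec_mem_other)
qed

definition fill_row :: "nat \<Rightarrow> nat \<Rightarrow> iexp \<Rightarrow> rexp \<Rightarrow> com" where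
  "fill_row r a i e = For r (IReg 0) (assign (Loc a i (IReg r)) e)"

lemma fill_row_simps [simp]:
  "written (fill_row r a i e) = {tmp_arr, a}" "set_regs (fill_row r a i e) = insert r (bound_regs e)"
  "dim_loops (fill_row r a i e)"
  by (auto simp: fill_row_def)

text \<open>The assumption on \<open>F\<close> describes the states in which \<open>e\<close> gets evaluated: the row is partially
filled, but its entry \<open>k\<close> and everything outside the row and the temporary array is still as in
\<open>s\<close>.  Hence \<open>e\<close> may read the other rows of the array and the very entry that it overwrites.\<close>
lemma mem_fill_row:
  assumes e: "well_scoped e" "tmp_arr \<notin> read_arrs e" "bound_regs e \<inter> insert r (iregs i) = {}" "a \<noteq> tmp_arr"
    and r: "r \<notin> insert 0 (iregs i)" "0 \<notin> bound_regs e"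
    and F: "\<And>k t. k < idx s 0 \<Longrightarrow> idx t r = k \<Longrightarrow> (\<And>q. q \<notin> insert r (bound_regs e) \<Longrightarrow> idx t q = idx s q) \<Longrightarrow>
        (\<And>a'. a' \<noteq> a \<Longrightarrow> a' \<noteq> tmp_arr \<Longrightarrow> mem t a' = mem s a') \<Longrightarrow>
        (\<And>i'. i' \<noteq> ival i s \<Longrightarrow> mem t a i' = mem s a i') \<Longrightarrow>
        mem t a (ival i s) k = mem s a (ival i s) k \<Longrightarrow> reval e t = F k"
  shows "mem (exec d f \<gamma> (fill_row r a i e) s) a =
     (mem s a)(ival i s := (\<lambda>j. if j < idx s 0 then F j else mem s a (ival i s) j))"
proof -
  let ?I = "\<lambda>k t. mem t a = (mem s a)(ival i s := (\<lambda>j. if j < k then F j else mem s a (ival i s) j)) \<and>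
    (\<forall>a'. a' \<noteq> a \<longrightarrow> a' \<noteq> tmp_arr \<longrightarrow> mem t a' = mem s a') \<and>
    (\<forall>q. q \<notin> insert r (bound_regs e) \<longrightarrow> idx t q = idx s q)"
  have "?I (ival (IReg 0) s) (exec d f \<gamma> (For r (IReg 0) (assign (Loc a i (IReg r)) e)) s)"
  proof (rule for_rule[where I = ?I], goal_cases)
    case (2 k t)
    let ?t = "set_idx r k t"
    have "ival i ?t = ival i s"
      by (rule ival_cong) (use 2 r(1) e(3) in auto)
    moreover have "reval e ?t = F k"
      by (rule F) (use 2 in auto)
    ultimately have "mem (exec d f \<gamma> (assign (Loc a i (IReg r)) e) ?t) a =
        (mem t a)(ival i s := (mem t a (ival i s))(k := F k))"
      using e by (subst mem_assign) auto
    with 2 show ?case by (auto simp: exec_mem_other exec_idx_other fun_eq_iff less_Suc_eq)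
  qed auto
  then show ?thesis by (simp add: fill_row_def)
qed

definition fill_mat :: "nat \<Rightarrow> nat \<Rightarrow> nat \<Rightarrow> rexp \<Rightarrow> com" where
  "fill_mat p r a e = For p (IReg 0) (fill_row r a (IReg p) e)"

lemma fill_mat_simps [simp]:
  "written (fill_mat p r a e) = {tmp_arr, a}" "set_regs (fill_mat p r a e) = insert p (insert r (bound_regs e))"
  "dim_loops (fill_mat p r a e)"
  by (auto simp: fill_mat_def)

text \<open>As for a single row; the only entry of the array that \<open>e\<close> may read is the one that it overwrites,
which suffices for updates in place.\<close>
lemma mem_fill_mat:
  assumes e: "well_scoped e" "tmp_arr \<notin> read_arrs e" "bound_regs e \<inter> {0, p, r} = {}" "a \<noteq> tmp_arr"
    and r: "distinct [0, p, r]"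
    and F: "\<And>i k t. i < idx s 0 \<Longrightarrow> k < idx s 0 \<Longrightarrow> idx t p = i \<Longrightarrow> idx t r = k \<Longrightarrow>
        (\<And>q. q \<notin> {p, r} \<union> bound_regs e \<Longrightarrow> idx t q = idx s q) \<Longrightarrow>
        (\<And>a'. a' \<noteq> a \<Longrightarrow> a' \<noteq> tmp_arr \<Longrightarrow> mem t a' = mem s a') \<Longrightarrow>
        mem t a i k = mem s a i k \<Longrightarrow> reval e t = F i k"
  shows "mem (exec d f \<gamma> (fill_mat p r a e) s) a =
     (\<lambda>i j. if i < idx s 0 \<and> j < idx s 0 then F i j else mem s a i j)"
proof -
  let ?I = "\<lambda>i t. mem t a = (\<lambda>i' j. if i' < i \<and> j < idx s 0 then F i' j else mem s a i' j) \<and>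
    (\<forall>a'. a' \<noteq> a \<longrightarrow> a' \<noteq> tmp_arr \<longrightarrow> mem t a' = mem s a') \<and>
    (\<forall>q. q \<notin> {p, r} \<union> bound_regs e \<longrightarrow> idx t q = idx s q)"
  have "?I (ival (IReg 0) s) (exec d f \<gamma> (For p (IReg 0) (fill_row r a (IReg p) e)) s)"
  proof (rule for_rule[where I = ?I], goal_cases)
    case (2 i t)
    let ?t = "set_idx p i t"
    have "mem (exec d f \<gamma> (fill_row r a (IReg p) e) ?t) a =
        (mem ?t a)(ival (IReg p) ?t := (\<lambda>j. if j < idx ?t 0 then F i j else mem ?t a (ival (IReg p) ?t) j))"
    proof (rule mem_fill_row, goal_cases)
      case (7 k u)
      have "idx u q = idx s q" if "q \<notin> {p, r} \<union> bound_regs e" for q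
        using 7(3)[of q] 2 that by auto
      moreover have "mem u a' = mem s a'" if "a' \<noteq> a" "a' \<noteq> tmp_arr" for a'
        using 7(4)[of a'] 2 that by auto
      moreover have "idx u p = i" using 7(3)[of p] e r by auto
      moreover have "mem u a i k = mem s a i k" using 7(6) 2 by auto
      moreover have "k < idx s 0" "i < idx s 0" using 7(1) 2 e r by auto
      ultimately show ?case by (intro F 7(2))
    qed (use e r in auto)
    with 2 e r show ?case by (auto simp: exec_mem_other exec_idx_other fun_eq_iff less_Suc_eq)
  qed auto
  then show ?thesis by (simp add: fill_mat_def)
qed

section \<open>The program\<close>

text \<open>The arrays \<open>pt_arr\<close>, \<open>in_arr\<close> and \<open>out_arr\<close> and register \<open>0\<close> are those of \<^const>\<open>init_state\<close> and
\<^const>\<open>method_out\<close>.  Registers: \<open>1\<close> for the main loop, \<open>2\<close> and \<open>3\<close> for filling rows and matrices,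
\<open>4\<close> for sums, \<open>5\<close> for the index of the best candidate.  The threshold for candidates and the best
value have to survive from step to step and sit in \<open>sc_arr\<close>, apart from the scratch values in
\<open>wk_arr\<close>, so that only the selection writes to their array inside the loop.\<close>
abbreviation (input) "pt_arr \<equiv> 0::nat"
abbreviation (input) "in_arr \<equiv> 1::nat"
abbreviation (input) "out_arr \<equiv> 2::nat"
abbreviation (input) "sg_arr \<equiv> 3::nat"
abbreviation (input) "inv_arr \<equiv> 4::nat"
abbreviation (input) "rhs_arr \<equiv> 5::nat"
abbreviation (input) "sc_arr \<equiv> 6::nat"
abbreviation (input) "dl_arr \<equiv> 8::nat"
abbreviation (input) "res_arr \<equiv> 9::nat"
abbreviation (input) "col_arr \<equiv> 10::nat"

abbreviation (input) "reg_k \<equiv> IReg 1"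
abbreviation (input) "reg_p \<equiv> IReg 2"
abbreviation (input) "reg_q \<equiv> IReg 3"
abbreviation (input) "reg_m \<equiv> IReg 4"
abbreviation (input) "reg_best \<equiv> IReg 5"
abbreviation (input) "next_k \<equiv> IAdd (IReg 1) (IConst 1)"
abbreviation (input) "zero_ix \<equiv> IConst 0"

abbreviation (input) "wk_arr \<equiv> 11::nat"
abbreviation (input) "work n \<equiv> Loc wk_arr zero_ix (IConst n)"
abbreviation (input) "scalar n \<equiv> Loc sc_arr zero_ix (IConst n)"

abbreviation (input) ent :: "nat \<Rightarrow> iexp \<Rightarrow> iexp \<Rightarrow> rexp" where "ent a i j \<equiv> Val (Loc a i j)"

abbreviation (input) seq_com :: "com \<Rightarrow> com \<Rightarrow> com" (infixr ";;" 60) where "c1 ;; c2 \<equiv> Seq c1 c2"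

text \<open>One step of Greville's recursion for row \<open>k\<close> of \<open>sg_arr\<close>: coefficients, residual, new column,
update.  The stored pseudoinverse has zero columns from \<open>k\<close> on, so that the coefficient vector is
zero from \<open>k\<close> on as well.  Overwriting its entry \<open>k\<close> by \<open>-1\<close> makes a single rank-one update
\<open>P - b \<delta>\<^sup>T\<close> both correct the old columns and place \<open>b\<close> into column \<open>k\<close>.\<close>
definition greville_com :: com where
  "greville_com =
     fill_row 3 dl_arr zero_ix (Sum 4 (Op Mul (ent sg_arr reg_k reg_m) (ent inv_arr reg_m reg_q))) ;;
     fill_row 2 res_arr zero_ix
       (Op Sub (ent sg_arr reg_k reg_p)
          (Sum 4 (Op Mul (ent sg_arr reg_m reg_p) (ent dl_arr zero_ix reg_m)))) ;;
     assign (work 1) (Sum 4 (Op Mul (ent res_arr zero_ix reg_m) (ent res_arr zero_ix reg_m))) ;;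
     Lit (work 2) 0 ;;
     IfLe (work 1) (work 2)
       (fill_row 2 col_arr zero_ix
          (Op Div (Sum 4 (Op Mul (ent inv_arr reg_p reg_m) (ent dl_arr zero_ix reg_m)))
             (Op Add (Num 1) (Sum 4 (Op Mul (ent dl_arr zero_ix reg_m) (ent dl_arr zero_ix reg_m))))))
       (fill_row 2 col_arr zero_ix (Op Div (ent res_arr zero_ix reg_p) (Val (work 1)))) ;;
     assign (Loc dl_arr zero_ix reg_k) (Num (-1)) ;;
     fill_mat 2 3 inv_arr
       (Op Sub (ent inv_arr reg_p reg_q) (Op Mul (ent col_arr zero_ix reg_p) (ent dl_arr zero_ix reg_q)))"

definition residual_com :: com where
  "residual_com =
     EvalF (work 0) pt_arr reg_k ;;
     assign (Loc rhs_arr zero_ix reg_k)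
       (Op Add (Op Sub (Val (work 0)) (ent in_arr zero_ix zero_ix))
          (Sum 4 (Op Mul (ent sg_arr reg_k reg_m)
             (Op Sub (ent pt_arr zero_ix reg_m) (ent pt_arr reg_k reg_m)))))"

definition point_com :: com where
  "point_com =
     fill_row 2 pt_arr next_k
       (Op Sub (ent pt_arr zero_ix reg_p)
          (Sum 4 (Op Mul (ent inv_arr reg_p reg_m) (ent rhs_arr zero_ix reg_m)))) ;;
     EvalG sg_arr next_k pt_arr next_k"

definition keep_com :: com where
  "keep_com = SetI 5 next_k ;; Copy (scalar 1) (work 0)"

text \<open>Candidates have positive indices, so \<open>0\<close> in register \<open>5\<close> means that there has been none.\<close>
definition select_com :: com where
  "select_com =
     EvalF (work 0) pt_arr next_k ;;
     assign (work 3) (Root (Sum 4 (Op Mul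
       (Op Sub (ent pt_arr next_k reg_m) (ent pt_arr zero_ix reg_m))
       (Op Sub (ent pt_arr next_k reg_m) (ent pt_arr zero_ix reg_m))))) ;;
     IfLe (work 3) (scalar 0)
       (IfIdxLe reg_best zero_ix keep_com (IfLe (scalar 1) (work 0) Skip keep_com))
       Skip"

definition polyak_com :: com where
  "polyak_com =
     EvalG sg_arr zero_ix pt_arr zero_ix ;;
     EvalF (work 0) pt_arr zero_ix ;;
     assign (scalar 0)
       (Op Mul (ent in_arr zero_ix (IConst 1)) (Op Sub (Val (work 0)) (ent in_arr zero_ix zero_ix))) ;;
     For 1 (IReg 0) (residual_com ;; greville_com ;; point_com ;; select_com) ;;
     fill_row 2 out_arr zero_ix (ent pt_arr reg_best reg_p)"

section \<open>Correctness and cost of the program\<close>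

abbreviation (input) pts :: "nat \<Rightarrow> state \<Rightarrow> nat \<Rightarrow> real vec" where "pts d s i \<equiv> row_vec d pt_arr i s"
abbreviation (input) sgs :: "nat \<Rightarrow> state \<Rightarrow> nat \<Rightarrow> real vec" where "sgs d s i \<equiv> row_vec d sg_arr i s"

text \<open>Padding with zero columns lets every loop run over the full dimension, whatever the number \<open>k\<close> of
rows is.\<close>
definition inv_stored :: "nat \<Rightarrow> nat \<Rightarrow> state \<Rightarrow> bool" where
  "inv_stored d k s \<longleftrightarrow>
     is_pinv (bundle_mat d (sgs d s) k) (mat d k (\<lambda>(p, j). mem s inv_arr p j)) \<and>
     (\<forall>p<d. \<forall>j<d. k \<le> j \<longrightarrow> mem s inv_arr p j = 0)"

lemma bundle_mat_carrier: "bundle_mat d vs k \<in> carrier_mat k d"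
  by (auto simp: bundle_mat_def)

lemma bundle_mat_index: "j < k \<Longrightarrow> p < d \<Longrightarrow> bundle_mat d vs k $$ (j, p) = vs j $ p"
  by (simp add: bundle_mat_def mat_of_rows_def)

lemma bundle_mat_Suc: "bundle_mat d vs (Suc k) = add_row (bundle_mat d vs k) (vs k)"
  using bundle_mat_carrier[of d vs k] bundle_mat_carrier[of d vs "Suc k"]
  by (intro eq_matI) (auto simp: add_row_def bundle_mat_index less_Suc_eq)

lemma sum_zero_padded:
  fixes h :: "nat \<Rightarrow> real"
  assumes "k \<le> d" "\<And>j. k \<le> j \<Longrightarrow> j < d \<Longrightarrow> h j = 0"
  shows "(\<Sum>j<d. h j) = (\<Sum>j<k. h j)"
  by (rule sum.mono_neutral_right) (use assms in \<open>auto simp: not_less\<close>)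

lemma greville_com_correct:
  assumes d: "idx s 0 = d" and k: "idx s 1 = k" "k < d" and inv: "inv_stored d k s"
  shows "inv_stored d (Suc k) (exec d f \<gamma> greville_com s)"
proof -
  let ?V = "mem s sg_arr" and ?P = "mem s inv_arr"
  define A where "A = bundle_mat d (sgs d s) k"
  define X where "X = mat d k (\<lambda>(p, j). ?P p j)"
  define a where "a = sgs d s k"
  define \<delta> where "\<delta> = transpose_mat X *\<^sub>v a"
  define c where "c = a - transpose_mat A *\<^sub>v \<delta>"
  define b where "b = greville_col X \<delta> c"
  have A: "A \<in> carrier_mat k d" and X: "X \<in> carrier_mat d k" and a: "a \<in> carrier_vec d"
    by (auto simp: A_def X_def a_def row_vec_def bundle_mat_carrier)
  have A_ix: "A $$ (j, p) = ?V j p" if "j < k" "p < d" for j p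
    using that by (simp add: A_def bundle_mat_index row_vec_def)
  have P0: "?P p j = 0" if "p < d" "k \<le> j" "j < d" for p j
    using inv that by (simp add: inv_stored_def)
  have \<delta>_ix: "\<delta> $ j = (\<Sum>p<d. ?V k p * ?P p j)" if "j < k" for j
    using that by (auto simp: \<delta>_def X_def a_def row_vec_def scalar_prod_def lessThan_atLeast0 mult.commute intro!: sum.cong)
  have \<delta>: "\<delta> \<in> carrier_vec k" unfolding \<delta>_def by (rule mult_mat_vec_carrier[of _ k d]) (use X a in auto)
  have c_ix: "c $ p = ?V k p - (\<Sum>j<k. ?V j p * \<delta> $ j)" if "p < d" for p
    using that A \<delta> by (auto simp: c_def a_def row_vec_def scalar_prod_def lessThan_atLeast0 A_ix)
  have c: "c \<in> carrier_vec d"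
    unfolding c_def by (intro minus_carrier_vec a mult_mat_vec_carrier[of _ d k]) (use A \<delta> in auto)
  have cc: "c \<bullet> c = (\<Sum>p<d. c $ p * c $ p)"
    using c by (simp add: scalar_prod_def lessThan_atLeast0)
  have dd: "\<delta> \<bullet> \<delta> = (\<Sum>j<k. \<delta> $ j * \<delta> $ j)"
    using \<delta> by (simp add: scalar_prod_def lessThan_atLeast0)
  have Xd_ix: "(X *\<^sub>v \<delta>) $ p = (\<Sum>j<k. ?P p j * \<delta> $ j)" if "p < d" for p
    using that \<delta> by (simp add: X_def scalar_prod_def lessThan_atLeast0)
  have b: "b \<in> carrier_vec d" using c mult_mat_vec_carrier[OF X \<delta>] by (auto simp: b_def greville_col_def)

  \<comment> \<open>The coefficient vector as it is stored, padded with zeros.\<close>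
  define D where "D = (\<lambda>j. if j < k then \<delta> $ j else 0)"
  have D: "(\<Sum>p<d. ?V k p * ?P p j) = D j" if "j < d" for j
    using that P0 by (simp add: D_def \<delta>_ix)
  have sum_D: "(\<Sum>j<d. h j * D j) = (\<Sum>j<k. h j * \<delta> $ j)" for h :: "nat \<Rightarrow> real"
    using k(2) by (subst sum_zero_padded[of k]) (auto simp: D_def)
  have DD: "(\<Sum>j<d. D j * D j) = \<delta> \<bullet> \<delta>"
    using sum_D[of D] by (simp add: dd D_def)

  define s1 where "s1 = exec d f \<gamma> (fill_row 3 dl_arr zero_ix (Sum 4 (Op Mul (ent sg_arr reg_k reg_m) (ent inv_arr reg_m reg_q)))) s"
  have m1: "mem s1 dl_arr = (mem s dl_arr)(ival zero_ix s := (\<lambda>j. if j < idx s 0 then D j else mem s dl_arr (ival zero_ix s) j))"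
    unfolding s1_def by (rule mem_fill_row) (use d k D in auto)
  have i1: "idx s1 0 = d" "idx s1 1 = k" and o1: "mem s1 sg_arr = ?V" "mem s1 inv_arr = ?P"
    unfolding s1_def using d k by (simp_all add: exec_idx_other exec_mem_other)
  define s2 where "s2 = exec d f \<gamma> (fill_row 2 res_arr zero_ix
       (Op Sub (ent sg_arr reg_k reg_p)
          (Sum 4 (Op Mul (ent sg_arr reg_m reg_p) (ent dl_arr zero_ix reg_m))))) s1"
  have m2: "mem s2 res_arr = (mem s1 res_arr)(ival zero_ix s1 := (\<lambda>j. if j < idx s1 0 then c $ j else mem s1 res_arr (ival zero_ix s1) j))"
    unfolding s2_def by (rule mem_fill_row) (use d k i1 o1 m1 sum_D in \<open>auto simp: c_ix\<close>)
  have i2: "idx s2 0 = d" "idx s2 1 = k" and o2: "mem s2 sg_arr = ?V" "mem s2 inv_arr = ?P" "mem s2 dl_arr = mem s1 dl_arr"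
    unfolding s2_def using i1 o1 by (simp_all add: exec_idx_other exec_mem_other)
  define s3 where "s3 = exec d f \<gamma> (assign (work 1) (Sum 4 (Op Mul (ent res_arr zero_ix reg_m) (ent res_arr zero_ix reg_m)))) s2"
  have m3: "mem s3 wk_arr 0 1 = c \<bullet> c"
    unfolding s3_def by (subst mem_assign) (use d i1 i2 m2 in \<open>auto simp: cc\<close>)
  have i3: "idx s3 0 = d" "idx s3 1 = k" and o3: "mem s3 sg_arr = ?V" "mem s3 inv_arr = ?P" "mem s3 dl_arr = mem s1 dl_arr"
      "mem s3 res_arr = mem s2 res_arr"
    unfolding s3_def using i2 o2 by (simp_all add: exec_idx_other exec_mem_other)
  define s4 where "s4 = exec d f \<gamma> (Lit (work 2) 0) s3"
  have m4: "mem s4 wk_arr 0 1 = c \<bullet> c" "mem s4 wk_arr 0 2 = 0" and i4: "idx s4 0 = d" "idx s4 1 = k"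
      and o4: "mem s4 sg_arr = ?V" "mem s4 inv_arr = ?P" "mem s4 dl_arr = mem s1 dl_arr"
      "mem s4 res_arr = mem s2 res_arr"
    unfolding s4_def using i3 o3 m3 by simp_all
  define s5 where "s5 = exec d f \<gamma> (IfLe (work 1) (work 2)
       (fill_row 2 col_arr zero_ix
          (Op Div (Sum 4 (Op Mul (ent inv_arr reg_p reg_m) (ent dl_arr zero_ix reg_m)))
             (Op Add (Num 1) (Sum 4 (Op Mul (ent dl_arr zero_ix reg_m) (ent dl_arr zero_ix reg_m))))))
       (fill_row 2 col_arr zero_ix (Op Div (ent res_arr zero_ix reg_p) (Val (work 1))))) s4"
  have m5: "mem s5 col_arr = (mem (tick s4) col_arr)(ival zero_ix (tick s4) :=
     (\<lambda>j. if j < idx (tick s4) 0 then b $ j else mem (tick s4) col_arr (ival zero_ix (tick s4)) j))"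
  proof (cases "c \<bullet> c \<le> 0")
    case True
    then have "mem s4 wk_arr 0 1 \<le> mem s4 wk_arr 0 2" using m4 by simp
    then have s5: "s5 = exec d f \<gamma> (fill_row 2 col_arr zero_ix
        (Op Div (Sum 4 (Op Mul (ent inv_arr reg_p reg_m) (ent dl_arr zero_ix reg_m)))
           (Op Add (Num 1) (Sum 4 (Op Mul (ent dl_arr zero_ix reg_m) (ent dl_arr zero_ix reg_m))))))
        (tick s4)"
      by (simp add: s5_def)
    have b_ix: "b $ p = (\<Sum>j<k. ?P p j * \<delta> $ j) / (1 + \<delta> \<bullet> \<delta>)" if "p < d" for p
      using True that X Xd_ix[OF that] by (simp add: b_def greville_col_def)
    show ?thesis
      unfolding s5 by (rule mem_fill_row) (use d i1 i4 o4 m1 sum_D DD in \<open>auto simp: b_ix\<close>)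
  next
    case False
    then have "\<not> mem s4 wk_arr 0 1 \<le> mem s4 wk_arr 0 2" using m4 by simp
    then have s5: "s5 = exec d f \<gamma>
        (fill_row 2 col_arr zero_ix (Op Div (ent res_arr zero_ix reg_p) (Val (work 1)))) (tick s4)"
      by (simp add: s5_def)
    have b_ix: "b $ p = c $ p / (c \<bullet> c)" if "p < d" for p
      using False that c by (simp add: b_def greville_col_def)
    show ?thesis
      unfolding s5 by (rule mem_fill_row) (use d i1 i4 o4 m2 m4 in \<open>auto simp: b_ix\<close>)
  qed
  have i5: "idx s5 0 = d" "idx s5 1 = k" and o5: "mem s5 sg_arr = ?V" "mem s5 inv_arr = ?P" "mem s5 dl_arr = mem s1 dl_arr"
    unfolding s5_def using i4 o4 by (simp_all add: exec_idx_other exec_mem_other del: exec.simps)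
  define s6 where "s6 = exec d f \<gamma> (assign (Loc dl_arr zero_ix reg_k) (Num (-1))) s5"
  have m6: "mem s6 dl_arr = (mem s5 dl_arr)(ival zero_ix s5 := (mem s5 dl_arr (ival zero_ix s5))(ival reg_k s5 := reval (Num (-1)) s5))"
    unfolding s6_def by (rule mem_assign) auto
  have i6: "idx s6 0 = d" "idx s6 1 = k" and o6: "mem s6 sg_arr = ?V" "mem s6 inv_arr = ?P" "mem s6 col_arr = mem s5 col_arr"
    unfolding s6_def using i5 o5 by (simp_all add: exec_idx_other exec_mem_other)
  define s7 where "s7 = exec d f \<gamma> (fill_mat 2 3 inv_arr
       (Op Sub (ent inv_arr reg_p reg_q) (Op Mul (ent col_arr zero_ix reg_p) (ent dl_arr zero_ix reg_q)))) s6"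
  have m7: "mem s7 inv_arr = (\<lambda>p q. if p < idx s6 0 \<and> q < idx s6 0 then ?P p q - b $ p * (if q = k then - 1 else D q) else mem s6 inv_arr p q)"
    unfolding s7_def
    by (rule mem_fill_mat) (use d i1 i4 i5 i6 o5 o6 m1 m5 m6 in auto)
  have o7: "mem s7 sg_arr = ?V"
    unfolding s7_def using o6 by (simp_all add: exec_idx_other exec_mem_other)

  have s7: "exec d f \<gamma> greville_com s = s7"
    by (simp only: greville_com_def exec.simps(2) s1_def s2_def s3_def s4_def s5_def s6_def s7_def)
  have "sgs d s7 = sgs d s" using o7 by (simp add: row_vec_def)
  then have "bundle_mat d (sgs d s7) (Suc k) = add_row A a"
    by (simp add: bundle_mat_Suc A_def a_def)
  moreover have "mat d (Suc k) (\<lambda>(p, j). mem s7 inv_arr p j) = add_col (X - outer b \<delta>) b"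
    using X b \<delta> k(2) P0
    by (intro eq_matI) (auto simp: add_col_def outer_def m7 i6 D_def X_def less_Suc_eq)
  moreover have "is_pinv (add_row A a) (add_col (X - outer b \<delta>) b)"
    by (rule is_pinv_add_row[OF A a _ \<delta>_def c_def b_def]) (use inv in \<open>simp add: inv_stored_def A_def X_def\<close>)
  moreover have "mem s7 inv_arr p j = 0" if "p < d" "j < d" "Suc k \<le> j" for p j
    using that P0 by (simp add: m7 i6 D_def)
  ultimately show ?thesis unfolding s7 inv_stored_def by simp
qed

lemma exec_EvalG [simp]:
  "idx (exec d f \<gamma> (EvalG b i a j) s) = idx s"
  "mem (exec d f \<gamma> (EvalG b i a j) s) = (mem s)(b := (mem s b)(ival i s :=
     (\<lambda>p. if p < d then \<gamma> (queries s) (row_vec d a (ival j s) s) $ p else mem s b (ival i s) p)))"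
  by (auto simp: put_row_def row_vec_def fun_eq_iff simp del: mem_put_row)

lemma greville_com_simps [simp]:
  "written greville_com = {dl_arr, tmp_arr, res_arr, wk_arr, col_arr, inv_arr}"
  "set_regs greville_com = {2, 3, 4}" "dim_loops greville_com" "nesting greville_com = 2"
  by (auto simp: greville_com_def fill_row_def fill_mat_def assign_def)

lemma residual_com_simps [simp]:
  "written residual_com = {wk_arr, tmp_arr, rhs_arr}"
  "set_regs residual_com = {4}" "dim_loops residual_com" "nesting residual_com = 1"
  by (auto simp: residual_com_def assign_def)

lemma point_com_simps [simp]:
  "written point_com = {pt_arr, tmp_arr, sg_arr}"
  "set_regs point_com = {2, 4}" "dim_loops point_com" "nesting point_com = 2"
  by (auto simp: point_com_def assign_def fill_row_def)

lemma select_com_simps [simp]: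
  "written select_com = {sc_arr, wk_arr, tmp_arr}"
  "set_regs select_com = {4, 5}" "dim_loops select_com" "nesting select_com = 1"
  by (auto simp: select_com_def assign_def keep_com_def)

lemma polyak_com_simps [simp]:
  "0 \<notin> set_regs polyak_com" "dim_loops polyak_com" "nesting polyak_com = 3"
  by (auto simp: polyak_com_def fill_row_def assign_def)

lemma residual_com_correct:
  assumes "idx s 0 = d" "idx s 1 = k"
  shows "mem (exec d f \<gamma> residual_com s) rhs_arr 0 =
    (mem s rhs_arr 0)(k := f (pts d s k) - mem s in_arr 0 0 + sgs d s k \<bullet> (pts d s 0 - pts d s k))"
proof -
  let ?s = "exec d f \<gamma> (EvalF (work 0) pt_arr reg_k) s"
  have "mem (exec d f \<gamma> residual_com s) rhs_arr = (mem ?s rhs_arr)(ival zero_ix ?s :=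
      (mem ?s rhs_arr (ival zero_ix ?s))(ival reg_k ?s := reval (Op Add (Op Sub (Val (work 0)) (ent in_arr zero_ix zero_ix))
          (Sum 4 (Op Mul (ent sg_arr reg_k reg_m)
             (Op Sub (ent pt_arr zero_ix reg_m) (ent pt_arr reg_k reg_m))))) ?s))"
    unfolding residual_com_def exec.simps(2) by (rule mem_assign) auto
  then show ?thesis
    using assms by (simp add: row_vec_def scalar_prod_def lessThan_atLeast0)
qed

text \<open>As the stored columns from \<open>k\<close> on are zero, a sum over the full dimension computes the product with
the pseudoinverse proper.\<close>
lemma pinv_stored_mult:
  assumes "inv_stored d k s" "k \<le> d" "p < d"
  shows "(pinv (bundle_mat d (sgs d s) k) *\<^sub>v vec k h) $ p = (\<Sum>j<d. mem s inv_arr p j * h j)"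
proof -
  have "pinv (bundle_mat d (sgs d s) k) = mat d k (\<lambda>(p, j). mem s inv_arr p j)"
    using assms(1) by (auto simp: inv_stored_def intro: pinv_eqI)
  then have "(pinv (bundle_mat d (sgs d s) k) *\<^sub>v vec k h) $ p = (\<Sum>j<k. mem s inv_arr p j * h j)"
    using assms(3) by (simp add: scalar_prod_def lessThan_atLeast0)
  also have "\<dots> = (\<Sum>j<d. mem s inv_arr p j * h j)"
    using assms by (intro sum_zero_padded[symmetric]) (auto simp: inv_stored_def)
  finally show ?thesis .
qed

lemma point_com_correct:
  fixes f :: "real vec \<Rightarrow> real"
  assumes d: "idx s 0 = d" and k: "idx s 1 = k" "k < d" and inv: "inv_stored d (Suc k) s"
    and \<gamma>: "\<And>q y. y \<in> carrier_vec d \<Longrightarrow> \<gamma> q y \<in> carrier_vec d"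
  defines "t \<equiv> exec d f \<gamma> point_com s"
  shows "pts d t (Suc k) = pts d s 0 - pinv (bundle_mat d (sgs d s) (Suc k)) *\<^sub>v vec (Suc k) (mem s rhs_arr 0)"
    and "\<exists>q. sgs d t (Suc k) = \<gamma> q (pts d t (Suc k))"
    and "i \<noteq> Suc k \<Longrightarrow> pts d t i = pts d s i" "i \<noteq> Suc k \<Longrightarrow> sgs d t i = sgs d s i"
proof -
  let ?c = "fill_row 2 pt_arr next_k
       (Op Sub (ent pt_arr zero_ix reg_p)
          (Sum 4 (Op Mul (ent inv_arr reg_p reg_m) (ent rhs_arr zero_ix reg_m))))"
  define u where "u = exec d f \<gamma> ?c s"
  let ?F = "\<lambda>p. mem s pt_arr 0 p - (\<Sum>j<d. mem s inv_arr p j * mem s rhs_arr 0 j)"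
  have mu: "mem u pt_arr = (mem s pt_arr)(ival next_k s := (\<lambda>p. if p < idx s 0 then ?F p else mem s pt_arr (ival next_k s) p))"
    unfolding u_def by (rule mem_fill_row) (use d k in auto)
  have u: "idx u 1 = k" "mem u sg_arr = mem s sg_arr"
    unfolding u_def using k by (simp_all add: exec_idx_other exec_mem_other)
  have t: "t = exec d f \<gamma> (EvalG sg_arr next_k pt_arr next_k) u"
    by (simp only: t_def u_def point_com_def exec.simps(2))
  have pts_u: "pts d t i = pts d u i" for i unfolding t by (simp add: row_vec_def)
  have "dim_row (pinv (bundle_mat d (sgs d s) (Suc k))) = d"
    using pinv_eqI inv by (auto simp: inv_stored_def)
  then have dim: "dim_vec (pinv (bundle_mat d (sgs d s) (Suc k)) *\<^sub>v v) = d" for v by simp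
  then show "pts d t (Suc k) = pts d s 0 - pinv (bundle_mat d (sgs d s) (Suc k)) *\<^sub>v vec (Suc k) (mem s rhs_arr 0)"
    unfolding pts_u
  proof (intro eq_vecI)
    fix p assume "p < dim_vec (pts d s 0 - pinv (bundle_mat d (sgs d s) (Suc k)) *\<^sub>v vec (Suc k) (mem s rhs_arr 0))"
    then have p: "p < d" using dim by simp
    have "(pts d s 0 - pinv (bundle_mat d (sgs d s) (Suc k)) *\<^sub>v vec (Suc k) (mem s rhs_arr 0)) $ p = ?F p"
      using p k(2) dim pinv_stored_mult[OF inv, of p "mem s rhs_arr 0"]
      by (subst index_minus_vec) (simp_all add: row_vec_def del: index_mult_mat_vec)
    moreover have "pts d u (Suc k) $ p = ?F p" using p d k by (simp add: row_vec_def mu)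
    ultimately show "pts d u (Suc k) $ p = (pts d s 0 - pinv (bundle_mat d (sgs d s) (Suc k)) *\<^sub>v
        vec (Suc k) (mem s rhs_arr 0)) $ p" by simp
  qed (simp add: row_vec_def dim del: dim_mult_mat_vec)
  have c: "\<gamma> (queries u) (pts d t (Suc k)) \<in> carrier_vec d"
    by (rule \<gamma>) (simp add: row_vec_def)
  then have "sgs d t (Suc k) = \<gamma> (queries u) (pts d t (Suc k))"
    unfolding pts_u unfolding t using u by (intro eq_vecI) (auto simp: row_vec_def)
  then show "\<exists>q. sgs d t (Suc k) = \<gamma> q (pts d t (Suc k))" ..
  show "i \<noteq> Suc k \<Longrightarrow> pts d t i = pts d s i"
    unfolding pts_u using k by (simp add: row_vec_def mu)
  show "i \<noteq> Suc k \<Longrightarrow> sgs d t i = sgs d s i"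
    unfolding t using u by (simp add: row_vec_def)
qed

definition best_stored :: "nat \<Rightarrow> (real vec \<Rightarrow> real) \<Rightarrow> nat \<Rightarrow> state \<Rightarrow> bool" where
  "best_stored d f k s \<longleftrightarrow>
     (let I = {i \<in> {1..k}. enorm (pts d s i - pts d s 0) \<le> mem s sc_arr 0 0}; b = idx s 5 in
       (b = 0 \<and> I = {}) \<or>
       (b \<in> I \<and> mem s sc_arr 0 1 = f (pts d s b) \<and> (\<forall>i\<in>I. f (pts d s b) \<le> f (pts d s i))))"

text \<open>The selection rule in isolation: \<open>b\<close> is the best index of \<open>I\<close>, or \<open>0\<close> if there is none, and \<open>v\<close> its
value.\<close>
lemma is_best_insert:
  fixes F :: "nat \<Rightarrow> real"
  assumes "b = 0 \<and> I = {} \<or> b \<in> I \<and> v = F b \<and> (\<forall>i\<in>I. F b \<le> F i)" "0 \<notin> I" "n \<noteq> 0"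
    and b': "b' = (if b = 0 \<or> \<not> v \<le> F n then n else b)"
    and v': "v' = (if b = 0 \<or> \<not> v \<le> F n then F n else v)"
  shows "b' = 0 \<and> insert n I = {} \<or> b' \<in> insert n I \<and> v' = F b' \<and> (\<forall>i\<in>insert n I. F b' \<le> F i)"
proof (cases "b = 0 \<or> \<not> v \<le> F n")
  case True
  have "F n \<le> F i" if "i \<in> I" for i
    using assms(1,2) True that by force
  then show ?thesis using True b' v' by auto
next
  case False
  then show ?thesis using assms by auto
qed

lemma select_com_correct:
  assumes d: "idx s 0 = d" and k: "idx s 1 = k" and best: "best_stored d f k s"
  shows "best_stored d f (Suc k) (exec d f \<gamma> select_com s)"
    and "mem (exec d f \<gamma> select_com s) sc_arr 0 0 = mem s sc_arr 0 0"
proof -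
  define s1 where "s1 = exec d f \<gamma> (EvalF (work 0) pt_arr next_k) s"
  have s1: "idx s1 = idx s" "mem s1 wk_arr 0 0 = f (pts d s (Suc k))" "mem s1 sc_arr 0 0 = mem s sc_arr 0 0"
      "mem s1 sc_arr 0 1 = mem s sc_arr 0 1" "mem s1 sc_arr = mem s sc_arr" "mem s1 pt_arr = mem s pt_arr"
    unfolding s1_def using k by simp_all
  let ?e = "Op Sub (ent pt_arr next_k reg_m) (ent pt_arr zero_ix reg_m)"
  define s2 where "s2 = exec d f \<gamma> (assign (work 3) (Root (Sum 4 (Op Mul ?e ?e)))) s1"
  have "mem s2 wk_arr = (mem s1 wk_arr)(ival zero_ix s1 := (mem s1 wk_arr (ival zero_ix s1))(ival (IConst 3) s1 :=
      reval (Root (Sum 4 (Op Mul ?e ?e))) s1))"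
    unfolding s2_def by (rule mem_assign) auto
  moreover have "reval (Root (Sum 4 (Op Mul ?e ?e))) s1 = enorm (pts d s (Suc k) - pts d s 0)"
    using d k s1 by (simp add: enorm_def scalar_prod_def row_vec_def lessThan_atLeast0)
  moreover have "mem s2 sc_arr = mem s1 sc_arr" unfolding s2_def by (simp add: exec_mem_other)
  ultimately have m2: "mem s2 wk_arr 0 3 = enorm (pts d s (Suc k) - pts d s 0)"
      "mem s2 wk_arr 0 0 = f (pts d s (Suc k))" "mem s2 sc_arr 0 0 = mem s sc_arr 0 0"
      "mem s2 sc_arr 0 1 = mem s sc_arr 0 1"
    using s1 by simp_all
  have i2: "idx s2 1 = k" "idx s2 5 = idx s 5" and o2: "pts d s2 = pts d s"
    unfolding s2_def using s1 k by (simp_all add: exec_idx_other exec_mem_other row_vec_def)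
  define t where "t = exec d f \<gamma> (IfLe (work 3) (scalar 0)
       (IfIdxLe reg_best zero_ix keep_com (IfLe (scalar 1) (work 0) Skip keep_com)) Skip) s2"
  have t: "exec d f \<gamma> select_com s = t"
    by (simp only: select_com_def exec.simps(2) s1_def s2_def t_def)
  let ?ok = "enorm (pts d s (Suc k) - pts d s 0) \<le> mem s sc_arr 0 0"
  let ?upd = "?ok \<and> (idx s 5 = 0 \<or> \<not> mem s sc_arr 0 1 \<le> f (pts d s (Suc k)))"
  have idx_t: "idx t 5 = (if ?upd then Suc k else idx s 5)"
    and val_t: "mem t sc_arr 0 1 = (if ?upd then f (pts d s (Suc k)) else mem s sc_arr 0 1)"
    and thr_t: "mem t sc_arr 0 0 = mem s sc_arr 0 0" and pts_t: "pts d t = pts d s"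
    unfolding t_def using m2 i2 o2 by (auto simp: keep_com_def row_vec_def)
  show "mem (exec d f \<gamma> select_com s) sc_arr 0 0 = mem s sc_arr 0 0" using t thr_t by simp
  define I where "I = (\<lambda>n. {i \<in> {1..n}. enorm (pts d s i - pts d s 0) \<le> mem s sc_arr 0 0})"
  have I_Suc: "I (Suc k) = (if ?ok then insert (Suc k) (I k) else I k)"
    by (auto simp: I_def le_Suc_eq)
  have old: "idx s 5 = 0 \<and> I k = {} \<or> idx s 5 \<in> I k \<and> mem s sc_arr 0 1 = f (pts d s (idx s 5)) \<and>
      (\<forall>i\<in>I k. f (pts d s (idx s 5)) \<le> f (pts d s i))"
    using best by (simp only: best_stored_def Let_def I_def)
  have "idx t 5 = 0 \<and> I (Suc k) = {} \<or> idx t 5 \<in> I (Suc k) \<and> mem t sc_arr 0 1 = f (pts d s (idx t 5)) \<and>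
      (\<forall>i\<in>I (Suc k). f (pts d s (idx t 5)) \<le> f (pts d s i))"
  proof (cases ?ok)
    case True
    have "0 \<notin> I k" by (simp add: I_def)
    from is_best_insert[where F = "\<lambda>i. f (pts d s i)", OF old this nat.simps(3)[of k] refl refl] True
    show ?thesis unfolding I_Suc idx_t val_t by (simp only: if_True simp_thms)
  next
    case False
    then show ?thesis using old unfolding I_Suc idx_t val_t by (simp only: if_False simp_thms)
  qed
  then show "best_stored d f (Suc k) (exec d f \<gamma> select_com s)"
    unfolding t best_stored_def Let_def thr_t fun_cong[OF pts_t] by (simp only: I_def)
qed

text \<open>The arrays hold the first \<open>k\<close> steps of a run.  The right-hand side lags behind by one entry: the
entry of \<open>y\<^sub>k\<close> is filled in at the beginning of the step that first uses it.\<close>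
definition traced :: "nat \<Rightarrow> (real vec \<Rightarrow> real) \<Rightarrow> (real vec \<Rightarrow> real vec set) \<Rightarrow> real vec \<Rightarrow> nat \<Rightarrow> state \<Rightarrow> bool" where
  "traced d f g x k s \<longleftrightarrow>
     pts d s 0 = x \<and> (\<forall>i\<le>k. sgs d s i \<in> g (pts d s i)) \<and>
     (\<forall>i\<in>{1..k}. pts d s i = x - pinv (bundle_mat d (sgs d s) i) *\<^sub>v bundle_rhs d f (pts d s) (sgs d s) i) \<and>
     inv_stored d k s \<and>
     (\<forall>j<k. mem s rhs_arr 0 j = f (pts d s j) - min_val d f + sgs d s j \<bullet> (x - pts d s j))"

lemma bundle_mat_cong: "(\<And>j. j < i \<Longrightarrow> vs j = vs' j) \<Longrightarrow> bundle_mat d vs i = bundle_mat d vs' i"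
  unfolding bundle_mat_def by (intro arg_cong[where f = "mat_of_rows d"] map_cong) auto

definition loop_inv where
  "loop_inv d f g \<tau> x k s \<longleftrightarrow>
     idx s 0 = d \<and> mem s in_arr 0 0 = min_val d f \<and> mem s sc_arr 0 0 = \<tau> * (f x - min_val d f) \<and>
     traced d f g x k s \<and> best_stored d f k s"

text \<open>A step only appends row \<open>k + 1\<close> to the points and subgradients, while the matrices and right-hand
sides with index at most \<open>k + 1\<close> depend on earlier rows; so the equations already established
persist, and the new one is what the updated pseudoinverse yields.\<close>
lemma loop_step:
  assumes inv: "loop_inv d f g \<tau> x k s0" and k: "k < d"
    and \<gamma>: "\<And>q y. y \<in> carrier_vec d \<Longrightarrow> \<gamma> q y \<in> g y"
    and g: "\<And>y. y \<in> carrier_vec d \<Longrightarrow> g y \<subseteq> carrier_vec d"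
  shows "loop_inv d f g \<tau> x (Suc k)
    (exec d f \<gamma> (residual_com ;; greville_com ;; point_com ;; select_com) (set_idx 1 k s0))"
proof -
  define s where "s = set_idx 1 k s0"
  define s1 where "s1 = exec d f \<gamma> residual_com s"
  define s2 where "s2 = exec d f \<gamma> greville_com s1"
  define s3 where "s3 = exec d f \<gamma> point_com s2"
  define t where "t = exec d f \<gamma> select_com s3"
  have t: "exec d f \<gamma> (residual_com ;; greville_com ;; point_com ;; select_com) (set_idx 1 k s0) = t"
    by (simp only: exec.simps(2) s_def s1_def s2_def s3_def t_def)
  have s: "idx s 0 = d" "idx s 1 = k" "mem s = mem s0" "mem s in_arr 0 0 = min_val d f"
    "mem s sc_arr 0 0 = \<tau> * (f x - min_val d f)"
    using inv by (simp_all add: s_def loop_inv_def)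
  have tr: "traced d f g x k s" and best: "best_stored d f k s"
  proof -
    have "traced d f g x k s = traced d f g x k s0"
      unfolding traced_def inv_stored_def row_vec_def s(3) ..
    moreover have "best_stored d f k s = best_stored d f k s0"
      unfolding best_stored_def row_vec_def s(3) by (simp add: s_def)
    ultimately show "traced d f g x k s" "best_stored d f k s"
      using inv by (simp_all add: loop_inv_def)
  qed
  note other = exec_idx_other exec_mem_other
  have s1: "idx s1 0 = d" "idx s1 1 = k" "idx s1 5 = idx s 5" "mem s1 in_arr = mem s in_arr"
    "mem s1 sc_arr = mem s sc_arr" "mem s1 pt_arr = mem s pt_arr" "mem s1 sg_arr = mem s sg_arr"
    "mem s1 inv_arr = mem s inv_arr"
    unfolding s1_def using s by (simp_all add: other)
  have s2: "idx s2 0 = d" "idx s2 1 = k" "idx s2 5 = idx s 5" "mem s2 in_arr = mem s in_arr"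
    "mem s2 sc_arr = mem s sc_arr" "pts d s2 = pts d s" "sgs d s2 = sgs d s"
    "mem s2 rhs_arr = mem s1 rhs_arr"
    unfolding s2_def using s1 by (simp_all add: other row_vec_def)
  have rhs: "mem s2 rhs_arr 0 j = f (pts d s j) - min_val d f + sgs d s j \<bullet> (x - pts d s j)" if "j < Suc k" for j
    using residual_com_correct[of s d k f \<gamma>] that tr s s2(8)
    by (auto simp: s1_def traced_def less_Suc_eq)
  have "inv_stored d k s1"
    using tr s1 by (simp add: traced_def inv_stored_def row_vec_def)
  then have inv2: "inv_stored d (Suc k) s2"
    unfolding s2_def by (intro greville_com_correct s1 k)
  have s3: "idx s3 0 = d" "idx s3 1 = k" "idx s3 5 = idx s 5" "mem s3 in_arr = mem s in_arr"
    "mem s3 sc_arr = mem s sc_arr" "mem s3 inv_arr = mem s2 inv_arr" "mem s3 rhs_arr = mem s2 rhs_arr"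
    unfolding s3_def using s2 by (simp_all add: other)
  have \<gamma>c: "\<gamma> q y \<in> carrier_vec d" if "y \<in> carrier_vec d" for q y
    using \<gamma>[OF that] g[OF that] by blast
  note pc = point_com_correct[where f = f and \<gamma> = \<gamma>, OF s2(1,2) k inv2 \<gamma>c, folded s3_def,
    unfolded s2(7) fun_cong[OF s2(6)] fun_cong[OF s2(7)]]
  have old: "pts d s3 i = pts d s i" "sgs d s3 i = sgs d s i" if "i \<le> k" for i
    using pc(3,4)[of i] that by auto
  have bm: "bundle_mat d (sgs d s3) i = bundle_mat d (sgs d s) i" if "i \<le> Suc k" for i
    using that by (intro bundle_mat_cong old) auto
  have br: "bundle_rhs d f (pts d s3) (sgs d s3) i = bundle_rhs d f (pts d s) (sgs d s) i" if "i \<le> Suc k" for i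
    unfolding bundle_rhs_def using that old by (intro eq_vecI) auto
  have x: "pts d s 0 = x" using tr by (simp add: traced_def)
  have "vec (Suc k) (mem s2 rhs_arr 0) = bundle_rhs d f (pts d s) (sgs d s) (Suc k)"
    unfolding bundle_rhs_def using rhs x by (intro eq_vecI) auto
  then have new: "pts d s3 (Suc k) = x - pinv (bundle_mat d (sgs d s3) (Suc k)) *\<^sub>v
      bundle_rhs d f (pts d s3) (sgs d s3) (Suc k)"
    using pc(1) x bm[of "Suc k"] br[of "Suc k"] by simp
  have "pts d s3 (Suc k) \<in> carrier_vec d" by (simp add: row_vec_def)
  then have new_sg: "sgs d s3 (Suc k) \<in> g (pts d s3 (Suc k))"
    using pc(2) \<gamma> by auto
  have inv3: "inv_stored d (Suc k) s3"
    using inv2 bm[of "Suc k"] s3(6) s2(7) by (simp add: inv_stored_def)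
  have tr3: "traced d f g x (Suc k) s3"
    unfolding traced_def
  proof (intro conjI allI ballI impI)
    show "pts d s3 0 = x" using old[of 0] x by simp
    show "sgs d s3 i \<in> g (pts d s3 i)" if "i \<le> Suc k" for i
      using that new_sg old[of i] tr by (cases "i = Suc k") (auto simp: traced_def)
    show "pts d s3 i = x - pinv (bundle_mat d (sgs d s3) i) *\<^sub>v bundle_rhs d f (pts d s3) (sgs d s3) i"
      if "i \<in> {1..Suc k}" for i
      using that new old[of i] bm[of i] br[of i] tr by (cases "i = Suc k") (auto simp: traced_def)
    show "inv_stored d (Suc k) s3" by (rule inv3)
    show "mem s3 rhs_arr 0 j = f (pts d s3 j) - min_val d f + sgs d s3 j \<bullet> (x - pts d s3 j)"
      if "j < Suc k" for j
      using that rhs[OF that] old[of j] s3(7) by simp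
  qed
  have best3: "best_stored d f k s3"
  proof -
    have "{i \<in> {1..k}. enorm (pts d s3 i - pts d s3 0) \<le> mem s3 sc_arr 0 0} =
        {i \<in> {1..k}. enorm (pts d s i - pts d s 0) \<le> mem s sc_arr 0 0}"
      using old s3(5) by auto
    then show ?thesis using best s3 old unfolding best_stored_def by (auto simp: Let_def)
  qed
  have "traced d f g x (Suc k) t"
    using tr3 unfolding t_def traced_def inv_stored_def row_vec_def by (simp add: other)
  moreover have "best_stored d f (Suc k) t" "mem t sc_arr 0 0 = mem s3 sc_arr 0 0"
    unfolding t_def using select_com_correct[OF s3(1,2) best3] by auto
  moreover have "idx t 0 = d" "mem t in_arr = mem s in_arr"
    unfolding t_def using s3 by (simp_all add: other)
  ultimately show ?thesis unfolding t loop_inv_def using s s3 by simp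
qed

lemma row_vec_restrict:
  "v \<in> carrier_vec d \<Longrightarrow> mem s a i = (\<lambda>p. if p < d then v $ p else h p) \<Longrightarrow> row_vec d a i s = v"
  by (intro eq_vecI) (auto simp: row_vec_def)

lemma is_pinv_no_rows: "A \<in> carrier_mat 0 n \<Longrightarrow> is_pinv A (mat n 0 h)"
  unfolding is_pinv_def by (auto intro!: eq_matI) (simp add: scalar_prod_def)

lemma init_loop_inv:
  assumes x: "x \<in> carrier_vec d"
    and \<gamma>: "\<And>q y. y \<in> carrier_vec d \<Longrightarrow> \<gamma> q y \<in> g y"
    and g: "\<And>y. y \<in> carrier_vec d \<Longrightarrow> g y \<subseteq> carrier_vec d"
  shows "loop_inv d f g \<tau> x 0
    (exec d f \<gamma> (EvalG sg_arr zero_ix pt_arr zero_ix ;; EvalF (work 0) pt_arr zero_ix ;;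
       assign (scalar 0)
         (Op Mul (ent in_arr zero_ix (IConst 1)) (Op Sub (Val (work 0)) (ent in_arr zero_ix zero_ix))))
     (init_state d (min_val d f) \<tau> x))"
proof -
  define s0 where "s0 = init_state d (min_val d f) \<tau> x"
  define s1 where "s1 = exec d f \<gamma> (EvalG sg_arr zero_ix pt_arr zero_ix) s0"
  define s2 where "s2 = exec d f \<gamma> (EvalF (work 0) pt_arr zero_ix) s1"
  let ?e = "Op Mul (ent in_arr zero_ix (IConst 1)) (Op Sub (Val (work 0)) (ent in_arr zero_ix zero_ix))"
  define t where "t = exec d f \<gamma> (assign (scalar 0) ?e) s2"
  have s0: "row_vec d pt_arr 0 s0 = x" "mem s0 in_arr 0 0 = min_val d f" "mem s0 in_arr 0 1 = \<tau>"
    "idx s0 0 = d" "idx s0 5 = 0" "mem s0 inv_arr p j = 0" for p j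
    using x by (auto simp: s0_def init_state_def row_vec_def)
  have "\<gamma> (queries s0) x \<in> g x" "\<gamma> (queries s0) x \<in> carrier_vec d" using \<gamma>[OF x] g[OF x] by blast+
  moreover have "mem s1 sg_arr 0 = (\<lambda>p. if p < d then \<gamma> (queries s0) x $ p else mem s0 sg_arr 0 p)"
    unfolding s1_def by (simp only: exec_EvalG ival.simps s0(1) fun_upd_same)
  ultimately have sg1: "row_vec d sg_arr 0 s1 \<in> g x"
    using row_vec_restrict[of "\<gamma> (queries s0) x" d s1 sg_arr 0] by simp
  have s1: "row_vec d pt_arr 0 s1 = x" "mem s1 in_arr = mem s0 in_arr" "idx s1 = idx s0" "mem s1 inv_arr = mem s0 inv_arr"
    using s0 by (simp_all add: s1_def row_vec_def)
  have s2: "mem s2 wk_arr 0 0 = f x" "mem s2 in_arr = mem s0 in_arr" "mem s2 pt_arr = mem s1 pt_arr"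
     "mem s2 sg_arr = mem s1 sg_arr" "mem s2 inv_arr = mem s0 inv_arr" "idx s2 = idx s0"
    unfolding s2_def using s1 by simp_all
  have "mem t sc_arr = (mem s2 sc_arr)(ival zero_ix s2 := (mem s2 sc_arr (ival zero_ix s2))(ival (IConst 0) s2 := reval ?e s2))"
    unfolding t_def by (rule mem_assign) auto
  then have "mem t sc_arr 0 0 = \<tau> * (f x - min_val d f)" using s0 s2 by simp
  moreover have "pts d t 0 = x" "sgs d t 0 \<in> g x" "mem t in_arr 0 0 = min_val d f" "mem t inv_arr = mem s0 inv_arr"
     "idx t = idx s0"
    unfolding t_def using s0 s1 s2 sg1 by (auto simp: exec_mem_other exec_idx_other row_vec_def fun_eq_iff)
  moreover have "is_pinv (bundle_mat d vs 0) (mat d 0 h)" for vs h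
    by (rule is_pinv_no_rows[OF bundle_mat_carrier])
  ultimately have "loop_inv d f g \<tau> x 0 t"
    using s0 by (simp add: loop_inv_def traced_def inv_stored_def best_stored_def Let_def)
  then show ?thesis by (simp only: t_def s2_def s1_def s0_def exec.simps(2))
qed

text \<open>The rows of the final arrays themselves are the run.  The oracle may answer repeated queries
differently, but it is asked once per point of the run, so its answers are the choices \<open>v\<^sub>i\<close>.\<close>
lemma polyak_com_correct:
  fixes f :: "real vec \<Rightarrow> real" and \<tau> :: real
  assumes x: "x \<in> carrier_vec d"
    and \<gamma>: "\<And>q y. y \<in> carrier_vec d \<Longrightarrow> \<gamma> q y \<in> g y"
    and g: "\<And>y. y \<in> carrier_vec d \<Longrightarrow> g y \<subseteq> carrier_vec d"
  defines "s \<equiv> run_method polyak_com d f \<gamma> \<tau> x"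
  obtains ys vs where "bundle_run d f g x ys vs"
    and "bundle_candidates d f \<tau> ys = {} \<or>
      (\<exists>b\<in>bundle_candidates d f \<tau> ys. (\<forall>i\<in>bundle_candidates d f \<tau> ys. f (ys b) \<le> f (ys i)) \<and> method_out d s = ys b)"
proof -
  let ?init = "EvalG sg_arr zero_ix pt_arr zero_ix ;; EvalF (work 0) pt_arr zero_ix ;;
       assign (scalar 0)
         (Op Mul (ent in_arr zero_ix (IConst 1)) (Op Sub (Val (work 0)) (ent in_arr zero_ix zero_ix)))"
  let ?body = "residual_com ;; greville_com ;; point_com ;; select_com"
  define s1 where "s1 = exec d f \<gamma> ?init (init_state d (min_val d f) \<tau> x)"
  define t where "t = exec d f \<gamma> (For 1 (IReg 0) ?body) s1"
  have inv1: "loop_inv d f g \<tau> x 0 s1"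
    unfolding s1_def by (rule init_loop_inv[OF x \<gamma> g])
  have "loop_inv d f g \<tau> x (ival (IReg 0) s1) t"
    unfolding t_def
  proof (rule for_rule[where I = "loop_inv d f g \<tau> x"], rule inv1)
    fix k u assume "k < ival (IReg 0) s1" "loop_inv d f g \<tau> x k u"
    then show "loop_inv d f g \<tau> x (Suc k) (exec d f \<gamma> ?body (set_idx 1 k u))"
      using inv1 by (intro loop_step \<gamma> g) (simp_all add: loop_inv_def)
  qed
  then have inv: "loop_inv d f g \<tau> x d t" using inv1 by (simp add: loop_inv_def)
  then have t0: "idx t 0 = d" by (simp add: loop_inv_def)
  have s: "s = exec d f \<gamma> (fill_row 2 out_arr zero_ix (ent pt_arr reg_best reg_p)) t"
    by (simp only: s_def t_def s1_def run_method_def polyak_com_def exec.simps(2))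
  have "mem s out_arr = (mem t out_arr)(ival zero_ix t :=
      (\<lambda>j. if j < idx t 0 then mem t pt_arr (idx t 5) j else mem t out_arr (ival zero_ix t) j))"
    unfolding s by (rule mem_fill_row) auto
  then have out: "method_out d s = pts d t (idx t 5)"
    using t0 by (auto simp: method_out_def row_vec_def)
  have run: "bundle_run d f g x (pts d t) (sgs d t)"
    using inv by (auto simp: loop_inv_def traced_def bundle_run_def)
  have "bundle_candidates d f \<tau> (pts d t) =
      {i \<in> {1..d}. enorm (pts d t i - pts d t 0) \<le> mem t sc_arr 0 0}"
    using inv by (auto simp: loop_inv_def traced_def bundle_candidates_def)
  moreover have "best_stored d f d t" using inv by (simp add: loop_inv_def)
  ultimately show thesis
    using out by (intro that[OF run]) (auto simp: best_stored_def Let_def)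
qed

lemma polyak_com_flops:
  assumes "1 \<le> d"
  shows "flops (run_method polyak_com d f \<gamma> \<tau> x) \<le> arith_count polyak_com * d ^ 3"
  using exec_flops[of polyak_com "init_state d (min_val d f) \<tau> x" d d f \<gamma>] assms
  by (simp add: run_method_def init_state_def)

theorem proposition5p1:
  shows "\<exists>(M :: com) (K :: nat).
    \<forall>(d :: nat) (f :: real vec \<Rightarrow> real) (g :: real vec \<Rightarrow> real vec set) (xbar :: real vec)
      (\<delta> :: real) (\<mu> :: real) (Cb :: real) (\<eta> :: real) (L :: real) (Cs :: real)
      (\<tau> :: real) (x :: real vec) (\<gamma> :: nat \<Rightarrow> real vec \<Rightarrow> real vec).
      locally_lipschitz d f \<longrightarrow>
      xbar \<in> argmin_set d f \<longrightarrow>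
      0 < \<delta> \<longrightarrow>
      sharp d f xbar \<delta> \<mu> \<longrightarrow>
      b_regular d f g xbar \<delta> Cb \<eta> \<longrightarrow>
      (\<forall>z\<in>eball d xbar \<delta>. \<forall>v\<in>g z. enorm v \<le> L) \<longrightarrow>
      lipschitz_with L f (eball d xbar \<delta>) \<longrightarrow>
      0 < Cs \<longrightarrow>
      (\<forall>\<tau>' x'. 3 / \<mu> < \<tau>' \<longrightarrow> near_solution d f xbar \<delta> \<mu> Cb \<eta> L Cs x' \<longrightarrow>
         (\<forall>r\<in>PolyakBundle d f g x' \<tau>'. \<exists>xt. r = Some xt \<and>
            f xt - min_val d f \<le> Cs * (f x' - min_val d f) powr (1 + \<eta>))) \<longrightarrow>
      3 / \<mu> < \<tau> \<longrightarrow>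
      near_solution d f xbar \<delta> \<mu> Cb \<eta> L Cs x \<longrightarrow>
      (\<forall>k. \<forall>y\<in>carrier_vec d. \<gamma> k y \<in> g y) \<longrightarrow>
      (let s = run_method M d f \<gamma> \<tau> x
       in Some (method_out d s) \<in> PolyakBundle d f g x \<tau> \<and> flops s \<le> K * d ^ 3)"
proof (rule exI[of _ polyak_com], rule exI[of _ "arith_count polyak_com"], intro allI impI)
  fix d :: nat and f :: "real vec \<Rightarrow> real" and g :: "real vec \<Rightarrow> real vec set" and xbar :: "real vec"
    and \<delta> \<mu> Cb \<eta> L Cs \<tau> :: real and x :: "real vec" and \<gamma> :: "nat \<Rightarrow> real vec \<Rightarrow> real vec"
  assume reg: "b_regular d f g xbar \<delta> Cb \<eta>"
    and Cs: "\<forall>\<tau>' x'. 3 / \<mu> < \<tau>' \<longrightarrow> near_solution d f xbar \<delta> \<mu> Cb \<eta> L Cs x' \<longrightarrow>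
         (\<forall>r\<in>PolyakBundle d f g x' \<tau>'. \<exists>xt. r = Some xt \<and>
            f xt - min_val d f \<le> Cs * (f x' - min_val d f) powr (1 + \<eta>))"
    and \<tau>: "3 / \<mu> < \<tau>" and near: "near_solution d f xbar \<delta> \<mu> Cb \<eta> L Cs x"
    and \<gamma>: "\<forall>k. \<forall>y\<in>carrier_vec d. \<gamma> k y \<in> g y"
  let ?s = "run_method polyak_com d f \<gamma> \<tau> x"
  have x: "x \<in> carrier_vec d" using near by (simp add: near_solution_def)
  obtain ys vs where run: "bundle_run d f g x ys vs"
    and out: "bundle_candidates d f \<tau> ys = {} \<or>
      (\<exists>b\<in>bundle_candidates d f \<tau> ys. (\<forall>i\<in>bundle_candidates d f \<tau> ys. f (ys b) \<le> f (ys i)) \<and> method_out d ?s = ys b)"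
    using polyak_com_correct[OF x, of \<gamma> g f \<tau>] \<gamma> reg unfolding b_regular_def by blast
  \<comment> \<open>The hypothesis on \<open>Cs\<close> covers every possible output, so no run at \<open>x\<close>, in particular not the
    program's, lacks candidates.  A candidate index lies in \<open>{1..d}\<close>, whence also \<open>1 \<le> d\<close>.\<close>
  have "None \<notin> PolyakBundle d f g x \<tau>" using Cs \<tau> near by fastforce
  then have ne: "bundle_candidates d f \<tau> ys \<noteq> {}"
    using run by (auto simp: PolyakBundle_def Let_def)
  with out run have "Some (method_out d ?s) \<in> PolyakBundle d f g x \<tau>"
    by (auto simp: PolyakBundle_def Let_def)
  moreover have "1 \<le> d" using ne by (auto simp: bundle_candidates_def)
  ultimately show "let s = ?s in
      Some (method_out d s) \<in> PolyakBundle d f g x \<tau> \<and> flops s \<le> arith_count polyak_com * d ^ 3"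
    using polyak_com_flops by (simp add: Let_def)
qed

end
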